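(* Let $V$ and $E$ be real reflexive Banach spaces, let $X$ be a real Banach space, and let $\Lambda\subset E$ be nonempty, closed and convex with $0_E\in\Lambda$. Let $A\colon V\to V^*$, $J\colon X\to\mathbb{R}$, $h\colon V\to\mathbb{R}$, $\gamma\colon V\to X$ and $b\colon V\times E\to\mathbb{R}$ satisfy the following hypotheses. On $A$: (A1) for all $w,v\in V$, $\limsup_{t\to0^+}\langle A(tw+(1-t)v),w-v\rangle\le\langle A(v),w-v\rangle$; (A2) $\langle A(u)+\gamma^*\xi_u-A(v)-\gamma^*\xi_v,u-v\rangle\ge h(u-v)$ for all $u,v\in V$, $\xi_u\in\partial J(\gamma u)$, $\xi_v\in\partial J(\gamma v)$; (A3) $\lim_{\|v\|_V\to+\infty}\frac{\langle A(v),v\rangle}{\|v\|_V^{\max\{\theta,1\}}}=+\infty$, where $\theta$ is the constant in (J2); (A4) $A$ maps bounded sets to bounded sets. On $J$: (J1) $J$ is locally Lipschitz continuous; (J2) there exist $\theta\ge0$, $\alpha_J\ge0$, $\beta_J>0$ such that $J^0(x;-x)\le\alpha_J+\beta_J\|x\|_X^\theta$ for all $x\in X$; (J3) $\partial J$ maps bounded subsets of $X$ into bounded subsets of $X^*$. On $h$: $h(0_V)=0$; (h1) $\limsup_{t\to0^+}\frac{h(tv)}{t}\ge0$ for all $v\in V$; (h2) whenever $v_n\to v$ weakly in $V$, $h(v)\le\limsup_{n\to\infty}h(v_n)$. On $b$: $b$ is bilinear and bounded, and there is $\alpha_b>0$ with $\inf_{\rho\in E\setminus\{0_E\}}\sup_{v\in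 V\setminus\{0_V\}}\frac{b(v,\rho)}{\|v\|_V\|\rho\|_E}\ge\alpha_b$. On $\gamma$: $\gamma$ is linear and continuous. For $f\in V^*$ let $\mathcal S(f)$ be the set of all $(u,\lambda)\in V\times\Lambda$ such that $\langle A(u),v-u\rangle+b(v-u,\lambda)+J^0(\gamma u;\gamma v-\gamma u)\ge\langle f,v-u\rangle$ for all $v\in V$ and $b(u,\rho-\lambda)\le0$ for all $\rho\in\Lambda$. Then: (i) for every $f\in V^*$, the set $\mathcal S(f)$ is bounded and weakly closed in $V\times\Lambda$; (ii) if $h$ is convex, then $\mathcal S(f)$ is convex for every $f\in V^*$; (iii) the multivalued mapping $\mathcal S\colon V^*\to2^{V\times\Lambda}$ maps bounded subsets of $V^*$ to bounded subsets of $V\times\Lambda$; (iv) $\mathcal S$ is strongly-weakly upper semicontinuous, i.e., upper semicontinuous from $V^*$ with the norm topology to the subsets of $V\times\Lambda$ with the weak topology, and it has a strongly-weakly closed graph.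
   Context: $\langle\cdot,\cdot\rangle$ is the duality pairing between $V^*$ and $V$, and $\gamma^*\colon X^*\to V^*$ is the adjoint of $\gamma$. For a locally Lipschitz function $J\colon X\to\mathbb{R}$, the generalized (Clarke) directional derivative at $x\in X$ in the direction $z\in X$ is $J^0(x;z)=\limsup_{t\to0^+,\,y\to x}\frac{J(y+tz)-J(y)}{t}$, and the generalized gradient is $\partial J(x)=\{\xi\in X^*\mid J^0(x;z)\ge\langle\xi,z\rangle_{X^*\times X}\text{ for all }z\in X\}$. A bilinear $b$ is bounded if $|b(v,\rho)|\le M\|v\|_V\|\rho\|_E$ for some $M\geq 0$ and all $v\in V$, $\rho\in E$. A multivalued mapping $F\colon Z\to2^W$ between topological spaces is upper semicontinuous if for every $z\in Z$ and every open $O\subset W$ with $F(z)\subset O$ there is a neighborhood $N$ of $z$ with $F(y)\subset O$ for all $y\in N$. It has a closed graph if, for every sequence $(z_n,w_n)$ with $w_n\in F(z_n)$ and $(z_n,w_n)\to(z_0,w_0)$ in $Z\times W$, one has $w_0\in F(z_0)$; here "strongly-weakly" means the norm topology on $Z=V^*$ and the weak topology (of $V\times E$) on $W=V\times\Lambda$. *)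

theory Defs
  imports "HOL-Analysis.Analysis"
begin

text \<open>The dual of a real normed space \<open>'a\<close> is the type \<open>'a \<Rightarrow>\<^sub>L real\<close>, with the operator norm.\<close>

definition reflexive_space :: "'a::real_normed_vector itself \<Rightarrow> bool" where
  "reflexive_space _ \<longleftrightarrow>
     (\<forall>\<Phi> :: ('a \<Rightarrow>\<^sub>L real) \<Rightarrow>\<^sub>L real. \<exists>x::'a. \<forall>\<phi>. blinfun_apply \<Phi> \<phi> = blinfun_apply \<phi> x)"

definition weak_topology :: "'a::real_normed_vector topology" where
  "weak_topology =
     topology_generated_by {blinfun_apply \<phi> -` U | (\<phi> :: 'a \<Rightarrow>\<^sub>L real) U. open U}"

lemma topspace_weak_topology [simp]: "topspace weak_topology = UNIV"
proof -
  have "blinfun_apply (0 :: 'a \<Rightarrow>\<^sub>L real) -` UNIV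
      \<in> {blinfun_apply \<phi> -` U | (\<phi> :: 'a \<Rightarrow>\<^sub>L real) U. open U}"
    by blast
  then show ?thesis
    unfolding weak_topology_def topology_generated_by_topspace by auto
qed

lemma limitin_weak_topology:
  fixes x :: "'a::real_normed_vector"
  shows "limitin weak_topology f x F \<longleftrightarrow>
    (\<forall>\<phi> :: 'a \<Rightarrow>\<^sub>L real. ((\<lambda>i. blinfun_apply \<phi> (f i)) \<longlongrightarrow> blinfun_apply \<phi> x) F)"
    (is "?L \<longleftrightarrow> ?R")
proof
  assume L: ?L
  show ?R
  proof (intro allI topological_tendstoI)
    fix \<phi> :: "'a \<Rightarrow>\<^sub>L real" and U :: "real set"
    assume U: "open U" "blinfun_apply \<phi> x \<in> U"
    have "openin weak_topology (blinfun_apply \<phi> -` U)"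
      unfolding weak_topology_def using U(1) by (intro topology_generated_by_Basis) blast
    with L U(2) show "\<forall>\<^sub>F i in F. blinfun_apply \<phi> (f i) \<in> U"
      unfolding limitin_def by auto
  qed
next
  assume R: ?R
  have "\<forall>\<^sub>F i in F. f i \<in> W"
    if "generate_topology_on {blinfun_apply \<phi> -` U | (\<phi> :: 'a \<Rightarrow>\<^sub>L real) U. open U} W" "x \<in> W" for W
    using that
  proof induction
    case (Int a b)
    then show ?case by (auto intro: eventually_conj)
  next
    case (UN K)
    then obtain k where k: "k \<in> K" "x \<in> k" by blast
    with UN have "\<forall>\<^sub>F i in F. f i \<in> k" by blast
    then show ?case using k by (auto elim: eventually_mono)
  next
    case (Basis s)
    then obtain \<phi> :: "'a \<Rightarrow>\<^sub>L real" and U where "s = blinfun_apply \<phi> -` U" "open U" by blast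
    with Basis R show ?case by (auto dest: topological_tendstoD)
  qed simp
  then show ?L
    unfolding limitin_def weak_topology_def openin_topology_generated_by_iff
    using topspace_weak_topology unfolding weak_topology_def by auto
qed

definition locally_lipschitz :: "('a::metric_space \<Rightarrow> 'b::metric_space) \<Rightarrow> bool" where
  "locally_lipschitz J \<longleftrightarrow> (\<forall>x. \<exists>r>0. \<exists>L. L-lipschitz_on (ball x r) J)"

text \<open>The upper limit is taken in the extended reals, so that it exists without any assumption on
  \<open>J\<close>; it is finite when \<open>J\<close> is locally Lipschitz. The points \<open>y\<close> tending to \<open>x\<close> may equal \<open>x\<close>.\<close>

definition clarke_deriv :: "('a::real_normed_vector \<Rightarrow> real) \<Rightarrow> 'a \<Rightarrow> 'a \<Rightarrow> ereal" where
  "clarke_deriv J x z =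
     Limsup (at_right 0 \<times>\<^sub>F nhds x) (\<lambda>(t, y). ereal ((J (y + t *\<^sub>R z) - J y) / t))"

definition clarke_gradient :: "('a::real_normed_vector \<Rightarrow> real) \<Rightarrow> 'a \<Rightarrow> ('a \<Rightarrow>\<^sub>L real) set" where
  "clarke_gradient J x = {\<xi>. \<forall>z. clarke_deriv J x z \<ge> ereal (blinfun_apply \<xi> z)}"

definition upper_semicontinuous_mv :: "'a topology \<Rightarrow> 'b topology \<Rightarrow> ('a \<Rightarrow> 'b set) \<Rightarrow> bool" where
  "upper_semicontinuous_mv Z W F \<longleftrightarrow>
     (\<forall>z\<in>topspace Z. F z \<subseteq> topspace W) \<and>
     (\<forall>z\<in>topspace Z. \<forall>G. openin W G \<and> F z \<subseteq> G \<longrightarrow>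
        (\<exists>N. openin Z N \<and> z \<in> N \<and> (\<forall>y\<in>N. F y \<subseteq> G)))"

definition seq_closed_graph :: "'a topology \<Rightarrow> 'b topology \<Rightarrow> ('a \<Rightarrow> 'b set) \<Rightarrow> bool" where
  "seq_closed_graph Z W F \<longleftrightarrow>
     (\<forall>zs ws z w. (\<forall>n. zs n \<in> topspace Z \<and> ws n \<in> F (zs n)) \<and>
        limitin (prod_topology Z W) (\<lambda>n. (zs n, ws n)) (z, w) sequentially \<longrightarrow> w \<in> F z)"

definition solution_set ::
  "('v::real_normed_vector \<Rightarrow> ('v \<Rightarrow>\<^sub>L real)) \<Rightarrow> ('v \<Rightarrow> 'e::real_normed_vector \<Rightarrow> real) \<Rightarrow>
   ('x::real_normed_vector \<Rightarrow> real) \<Rightarrow> ('v \<Rightarrow>\<^sub>L 'x) \<Rightarrow> 'e set \<Rightarrow> ('v \<Rightarrow>\<^sub>L real) \<Rightarrow> ('v \<times> 'e) set" where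
  "solution_set A b J \<gamma> \<Lambda> f =
     {(u, l). l \<in> \<Lambda> \<and>
        (\<forall>v. ereal (blinfun_apply (A u) (v - u) + b (v - u) l)
               + clarke_deriv J (blinfun_apply \<gamma> u) (blinfun_apply \<gamma> v - blinfun_apply \<gamma> u)
             \<ge> ereal (blinfun_apply f (v - u))) \<and>
        (\<forall>\<rho>\<in>\<Lambda>. b u (\<rho> - l) \<le> 0)}"

end

theory Submission
  imports Defs "HOL-Complex_Analysis.Great_Picard"
begin

text \<open>By (A2) and (h1), solutions satisfy an equivalent Minty-type inequality in which \<open>A\<close> and the
  Clarke gradient are evaluated only at the test point. Since \<open>b u \<rho> \<le> b u \<lambda>\<close> for all \<open>\<rho> \<in> \<Lambda>\<close>, the product
  \<open>b u \<lambda>\<close> can be replaced by \<open>b u \<rho>\<close>, so the inequality is weakly continuous and affine in \<open>(u, \<lambda>)\<close>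
  apart from the term \<open>h (v - u)\<close>. This gives the sequentially closed graph and convexity.
  Coercivity bounds \<open>u\<close> and the inf-sup condition bounds \<open>\<lambda>\<close>. As \<open>h\<close> is controlled along weakly
  convergent sequences only, the topological claims need two forms of the Eberlein--Smulian theorem:
  in a reflexive space a bounded sequence has a weakly convergent subsequence, and a point in the
  weak closure of a bounded set is the weak limit of a sequence in it. Both follow Whitley's
  argument, with Banach limits (Hahn--Banach on the dual) in place of weak compactness.\<close>

section \<open>Sublinear functionals and separation\<close>

text \<open>Only an inequality for positive scalars is demanded, which is what constructions can
  check directly. Equality follows by rescaling with the inverse.\<close>

definition sublinear :: "('a::real_vector \<Rightarrow> real) \<Rightarrow> bool" where
  "sublinear p \<longleftrightarrow>
     (\<forall>x y. p (x + y) \<le> p x + p y) \<and> (\<forall>c x. 0 < c \<longrightarrow> p (c *\<^sub>R x) \<le> c * p x)"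

lemma sublinearD:
  assumes "sublinear p"
  shows sublinear_add: "p (x + y) \<le> p x + p y"
    and sublinear_zero: "p 0 = 0"
    and sublinear_scale: "0 \<le> c \<Longrightarrow> p (c *\<^sub>R x) = c * p x"
    and sublinear_uminus: "- p (- x) \<le> p x"
proof -
  have sc: "p (c *\<^sub>R y) \<le> c * p y" if "0 < c" for c y
    using assms that unfolding sublinear_def by blast
  show add: "p (x + y) \<le> p x + p y" for x y
    using assms unfolding sublinear_def by blast
  show zero: "p 0 = 0"
    using sc[of 2 0] sc[of "1/2" 0] by simp
  show "p (c *\<^sub>R x) = c * p x" if "0 \<le> c"
  proof (cases "c = 0")
    case False
    with that have "c > 0" by simp
    then have "p x \<le> inverse c * p (c *\<^sub>R x)"
      using sc[of "inverse c" "c *\<^sub>R x"] by simp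
    then show ?thesis
      using sc[of c x] \<open>c > 0\<close> by (simp add: field_simps)
  qed (simp add: zero)
  show "- p (- x) \<le> p x"
    using add[of x "- x"] zero by simp
qed

lemma sublinear_norm: "sublinear (norm :: 'a::real_normed_vector \<Rightarrow> real)"
  by (simp add: sublinear_def norm_triangle_ineq)

text \<open>The infimum of \<open>p (y + t *\<^sub>R k) - t * d\<close> over
  \<open>t \<ge> 0\<close> and \<open>k \<in> K\<close> is the largest sublinear functional below
  \<open>p\<close> that is at most \<open>- d\<close> on the negatives of \<open>K\<close>. A linear
  functional below it is then at least \<open>d\<close> on \<open>K\<close>.\<close>

lemma sublinear_lower:
  assumes p: "sublinear p" and K: "convex K" "K \<noteq> {}" and d: "\<And>k. k \<in> K \<Longrightarrow> d \<le> p k"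
  obtains q where "sublinear q" "q \<le> p" "\<And>k. k \<in> K \<Longrightarrow> q (- k) \<le> - d"
proof -
  define S where "S y = {p (y + t *\<^sub>R k) - t * d | t k. 0 \<le> t \<and> k \<in> K}" for y
  define q where "q y = Inf (S y)" for y
  have SI: "p (y + t *\<^sub>R k) - t * d \<in> S y" if "0 \<le> t" "k \<in> K" for t k y
    unfolding S_def using that by blast
  have ne: "S y \<noteq> {}" for y
    using SI[of 0] K(2) by blast
  \<comment> \<open>The hypothesis \<open>d \<le> p k\<close> makes the infimum finite: this bound
    does not depend on \<open>t\<close> and \<open>k\<close>.\<close>
  have low: "- p (- y) \<le> s" if "s \<in> S y" for s y
  proof -
    from that obtain t k where s: "s = p (y + t *\<^sub>R k) - t * d" "0 \<le> t" "k \<in> K"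
      unfolding S_def by blast
    have "t * d \<le> p (t *\<^sub>R k)"
      using sublinear_scale[OF p s(2)] d[OF s(3)] s(2) by (simp add: mult_left_mono)
    moreover have "p (t *\<^sub>R k) \<le> p (y + t *\<^sub>R k) + p (- y)"
      using sublinear_add[OF p, of "y + t *\<^sub>R k" "- y"] by simp
    ultimately show ?thesis using s(1) by simp
  qed
  then have bdd: "bdd_below (S y)" for y by (meson bdd_belowI)
  have le: "q y \<le> p (y + t *\<^sub>R k) - t * d" if "0 \<le> t" "k \<in> K" for t k y
    unfolding q_def by (rule cInf_lower[OF SI[OF that] bdd])
  have ge: "c \<le> q y" if "\<And>t k. 0 \<le> t \<Longrightarrow> k \<in> K \<Longrightarrow> c \<le> p (y + t *\<^sub>R k) - t * d" for c y
    unfolding q_def by (rule cInf_greatest[OF ne]) (use that in \<open>auto simp: S_def\<close>)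
  have add: "q (x + y) \<le> q x + q y" for x y
  proof -
    have "q (x + y) - (p (x + t *\<^sub>R k) - t * d) \<le> p (y + s *\<^sub>R l) - s * d"
      if h: "0 \<le> t" "k \<in> K" "0 \<le> s" "l \<in> K" for t k s l
    proof -
      \<comment> \<open>Convexity merges two weighted points of \<open>K\<close> into one. If the
        total weight is zero, any point of \<open>K\<close> serves.\<close>
      obtain m where m: "m \<in> K" "t *\<^sub>R k + s *\<^sub>R l = (t + s) *\<^sub>R m"
      proof (cases "t + s = 0")
        case True
        then have "t = 0" "s = 0" using h by auto
        then show thesis using h that by auto
      next
        case False
        then have pos: "t + s > 0" using h by linarith
        have "(t / (t + s)) *\<^sub>R k + (s / (t + s)) *\<^sub>R l \<in> K"
          using h pos by (intro convexD[OF K(1)]) (auto simp: add_divide_distrib[symmetric])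
        moreover have "t *\<^sub>R k + s *\<^sub>R l = (t + s) *\<^sub>R ((t / (t + s)) *\<^sub>R k + (s / (t + s)) *\<^sub>R l)"
          using False by (simp add: scaleR_right_distrib)
        ultimately show thesis using that by blast
      qed
      have "q (x + y) \<le> p (x + y + (t + s) *\<^sub>R m) - (t + s) * d"
        using h m by (intro le) auto
      also have "x + y + (t + s) *\<^sub>R m = (x + t *\<^sub>R k) + (y + s *\<^sub>R l)"
        unfolding m(2)[symmetric] by simp
      finally show ?thesis
        using sublinear_add[OF p, of "x + t *\<^sub>R k" "y + s *\<^sub>R l"] by (simp add: algebra_simps)
    qed
    then have "q (x + y) - (p (x + t *\<^sub>R k) - t * d) \<le> q y" if "0 \<le> t" "k \<in> K" for t k
      using that by (intro ge) auto
    then have "q (x + y) - q y \<le> q x"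
      by (intro ge) (simp add: algebra_simps)
    then show ?thesis by simp
  qed
  have scale: "q (c *\<^sub>R x) \<le> c * q x" if "0 < c" for c x
  proof -
    have "q (c *\<^sub>R x) / c \<le> q x"
    proof (rule ge)
      fix t k assume h: "(0::real) \<le> t" "k \<in> K"
      have "q (c *\<^sub>R x) \<le> p (c *\<^sub>R x + (c * t) *\<^sub>R k) - c * t * d"
        using h \<open>0 < c\<close> by (intro le) auto
      also have "c *\<^sub>R x + (c * t) *\<^sub>R k = c *\<^sub>R (x + t *\<^sub>R k)"
        by (simp add: scaleR_right_distrib)
      also have "p (c *\<^sub>R (x + t *\<^sub>R k)) = c * p (x + t *\<^sub>R k)"
        using \<open>0 < c\<close> by (intro sublinear_scale[OF p]) auto
      finally show "q (c *\<^sub>R x) / c \<le> p (x + t *\<^sub>R k) - t * d"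
        using \<open>0 < c\<close> by (simp add: field_simps)
    qed
    then show ?thesis using that by (simp add: field_simps)
  qed
  show thesis
  proof
    show "sublinear q" using add scale by (simp add: sublinear_def)
    show "q \<le> p"
    proof (rule le_funI)
      fix y show "q y \<le> p y" using le[of 0 _ y] K(2) by auto
    qed
    show "q (- k) \<le> - d" if "k \<in> K" for k
      using le[of 1 k "- k"] that sublinear_zero[OF p] by simp
  qed
qed

text \<open>By Zorn there is a minimal sublinear functional below the one just constructed; it is linear,
  since otherwise \<open>sublinear_lower\<close> with a singleton would produce a smaller one.\<close>

lemma mazur_orlicz:
  fixes p :: "'a::real_vector \<Rightarrow> real"
  assumes p: "sublinear p" and K: "convex K" "K \<noteq> {}" and d: "\<And>k. k \<in> K \<Longrightarrow> d \<le> p k"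
  obtains f where "linear f" "\<And>x. f x \<le> p x" "\<And>k. k \<in> K \<Longrightarrow> d \<le> f k"
proof -
  obtain p' where p': "sublinear p'" "p' \<le> p" "\<And>k. k \<in> K \<Longrightarrow> p' (- k) \<le> - d"
    using sublinear_lower[OF assms] by blast
  define A where "A = {q. sublinear q \<and> q \<le> p'}"
  have "\<exists>m\<in>A. \<forall>a\<in>A. a \<le> m \<longrightarrow> a = m"
  \<comment> \<open>The order is reversed, so maximal means minimal, and a nonempty chain is bounded
    by its pointwise infimum.\<close>
  proof (rule predicate_Zorn[where P = "\<lambda>a b. b \<le> a"])
    show "partial_order_on A (relation_of (\<lambda>a b. b \<le> a) A)"
      by (rule partial_order_on_relation_ofI) auto
    fix C assume C: "C \<in> Chains (relation_of (\<lambda>a b. b \<le> a) A)"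
    have CA: "C \<subseteq> A" using C unfolding Chains_def relation_of_def by auto
    have tot: "a \<le> b \<or> b \<le> a" if "a \<in> C" "b \<in> C" for a b
      using C that unfolding Chains_def relation_of_def by auto
    show "\<exists>u\<in>A. \<forall>a\<in>C. u \<le> a"
    proof (cases "C = {}")
      case True
      then show ?thesis using p'(1) by (auto simp: A_def)
    next
      case False
      define u where "u x = (INF q\<in>C. q x)" for x
      have bdd: "bdd_below ((\<lambda>q. q x) ` C)" for x
      proof (rule bdd_belowI2)
        fix q assume "q \<in> C"
        then have "sublinear q" "q \<le> p'" using CA by (auto simp: A_def)
        then show "- p' (- x) \<le> q x"
          using sublinear_uminus[of q x] le_funD[of q p' "- x"] by linarith
      qed
      have le: "u x \<le> q x" if "q \<in> C" for q x
        unfolding u_def by (rule cINF_lower[OF bdd that])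
      have ge: "c \<le> u x" if "\<And>q. q \<in> C \<Longrightarrow> c \<le> q x" for c x
        unfolding u_def by (rule cINF_greatest[OF False that])
      have sl: "sublinear q" if "q \<in> C" for q using that CA by (auto simp: A_def)
      have add: "u (x + y) \<le> u x + u y" for x y
      proof -
        have "u (x + y) - q x \<le> r y" if "q \<in> C" "r \<in> C" for q r
        proof -
          \<comment> \<open>In a chain the smaller of \<open>q\<close> and \<open>r\<close> lies
            below both; this is why the infimum stays subadditive.\<close>
          obtain s where s: "s \<in> C" "s \<le> q" "s \<le> r" using tot[of q r] \<open>q \<in> C\<close> \<open>r \<in> C\<close> by auto
          show ?thesis
            using le[OF s(1), of "x + y"] sublinear_add[OF sl[OF s(1)], of x y]
              le_funD[OF s(2), of x] le_funD[OF s(3), of y] by linarith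
        qed
        then have "u (x + y) - q x \<le> u y" if "q \<in> C" for q
          using that by (intro ge) auto
        then have "u (x + y) - u y \<le> u x"
          by (intro ge) (simp add: algebra_simps)
        then show ?thesis by simp
      qed
      have scale: "u (c *\<^sub>R x) \<le> c * u x" if "0 < c" for c x
      proof -
        have "u (c *\<^sub>R x) / c \<le> u x"
        proof (rule ge)
          fix q assume q: "q \<in> C"
          show "u (c *\<^sub>R x) / c \<le> q x"
            using le[OF q, of "c *\<^sub>R x"] sublinear_scale[OF sl[OF q], of c x] \<open>0 < c\<close>
            by (simp add: field_simps)
        qed
        then show ?thesis using that by (simp add: field_simps)
      qed
      have "u \<in> A"
      proof -
        obtain q where q: "q \<in> C" using False by blast
        then have "q \<le> p'" using CA by (auto simp: A_def)
        then have "u \<le> p'" using le[OF q] by (meson le_fun_def order_trans)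
        then show ?thesis using add scale by (simp add: A_def sublinear_def)
      qed
      then show ?thesis using le by (auto simp: le_fun_def)
    qed
  qed
  then obtain f where f: "sublinear f" "f \<le> p'" and min: "\<And>a. sublinear a \<Longrightarrow> a \<le> f \<Longrightarrow> a = f"
    unfolding A_def by (blast intro: order_trans)
  have neg: "f (- x) = - f x" for x
  proof -
    \<comment> \<open>With \<open>K = {x}\<close> and \<open>d = f x\<close>, minimality forces
      \<open>r = f\<close>, so \<open>f\<close> is odd. An odd sublinear functional is
      linear.\<close>
    obtain r where "sublinear r" "r \<le> f" "r (- x) \<le> - f x"
      using sublinear_lower[OF f(1), of "{x}" "f x"] by auto
    with min have "f (- x) \<le> - f x" by blast
    then show ?thesis using sublinear_uminus[OF f(1), of x] by simp
  qed
  show thesis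
  proof
    show "linear f"
    proof
      fix x y
      have "f x \<le> f (x + y) - f y"
        using sublinear_add[OF f(1), of "x + y" "- y"] neg[of y] by simp
      then show "f (x + y) = f x + f y"
        using sublinear_add[OF f(1), of x y] by simp
    next
      fix c x
      show "f (c *\<^sub>R x) = c *\<^sub>R f x"
      proof (cases "0 \<le> c")
        case True
        then show ?thesis using sublinear_scale[OF f(1)] by simp
      next
        case False
        then have "f ((- c) *\<^sub>R x) = - c * f x"
          by (intro sublinear_scale[OF f(1)]) simp
        then show ?thesis using neg[of "c *\<^sub>R x"] by simp
      qed
    qed
    show "f x \<le> p x" for x using f(2) p'(2) by (meson le_funD order_trans)
    show "d \<le> f k" if "k \<in> K" for k
      using p'(3)[OF that] le_funD[OF f(2), of "- k"] neg[of k] by linarith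
  qed
qed

section \<open>Continuous functionals: norming and separation\<close>

text \<open>Domination at both \<open>x\<close> and \<open>- x\<close> bounds the absolute value of
  the linear functional, hence makes it continuous.\<close>

lemma mazur_orlicz_blinfun:
  fixes p :: "'a::real_normed_vector \<Rightarrow> real"
  assumes p: "sublinear p" "\<And>x. p x \<le> L * norm x"
    and K: "convex K" "K \<noteq> {}" "\<And>k. k \<in> K \<Longrightarrow> d \<le> p k"
  obtains f :: "'a \<Rightarrow>\<^sub>L real" where "\<And>x. f x \<le> p x" "\<And>k. k \<in> K \<Longrightarrow> d \<le> f k"
proof -
  obtain g where g: "linear g" "\<And>x. g x \<le> p x" "\<And>k. k \<in> K \<Longrightarrow> d \<le> g k"
    using mazur_orlicz[OF p(1) K] by blast
  have "\<bar>g x\<bar> \<le> L * norm x" for x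
    using g(2)[of x] g(2)[of "- x"] p(2)[of x] p(2)[of "- x"] linear_neg[OF g(1), of x] by simp
  then have bl: "bounded_linear g"
    by (intro bounded_linear_intro[of g L])
      (auto simp: linear_add[OF g(1)] linear_scale[OF g(1)] mult.commute)
  show thesis
    by (rule that[of "Blinfun g"]) (use g bl in \<open>auto simp: bounded_linear_Blinfun_apply\<close>)
qed

lemma norming_functional:
  fixes x :: "'a::real_normed_vector"
  obtains f :: "'a \<Rightarrow>\<^sub>L real" where "norm f \<le> 1" "f x = norm x"
proof -
  obtain f :: "'a \<Rightarrow>\<^sub>L real" where f: "\<And>y. f y \<le> norm y" "\<And>k. k \<in> {x} \<Longrightarrow> norm x \<le> f k"
    by (rule mazur_orlicz_blinfun[OF sublinear_norm, of 1 "{x}" "norm x"]) auto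
  have "norm f \<le> 1"
  proof (rule norm_blinfun_bound)
    fix y show "norm (f y) \<le> 1 * norm y"
      using f(1)[of y] f(1)[of "- y"] by (simp add: blinfun.minus_right)
  qed simp
  moreover have "f x = norm x" using f(1)[of x] f(2)[of x] by simp
  ultimately show thesis using that by blast
qed

text \<open>Every point of \<open>z - S\<close> has norm at least the distance from \<open>z\<close>
  to \<open>S\<close>, so the norm can be replaced on this convex set by a linear functional with
  the same lower bound.\<close>

lemma separating_functional:
  fixes S :: "'a::real_normed_vector set"
  assumes "closed S" "convex S" "S \<noteq> {}" "z \<notin> S"
  obtains f :: "'a \<Rightarrow>\<^sub>L real" and d where "d > 0" "\<And>y. y \<in> S \<Longrightarrow> f y + d \<le> f z"
proof -
  define d where "d = infdist z S"
  have "d > 0" unfolding d_def using infdist_pos_not_in_closed assms by auto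
  have "convex ((\<lambda>y. z - y) ` S)"
    using convex_translation[OF convex_negations[OF assms(2)], of z] by (simp add: image_image)
  moreover have "d \<le> norm k" if "k \<in> (\<lambda>y. z - y) ` S" for k
    using that infdist_le[of _ S z] by (auto simp: d_def dist_norm)
  ultimately obtain f :: "'a \<Rightarrow>\<^sub>L real" where "\<And>k. k \<in> (\<lambda>y. z - y) ` S \<Longrightarrow> d \<le> f k"
    using mazur_orlicz_blinfun[OF sublinear_norm, of 1 "(\<lambda>y. z - y) ` S" d] assms(3)
    by (metis (no_types, lifting) image_is_empty mult_1 order_refl)
  then have "f y + d \<le> f z" if "y \<in> S" for y
    using that by (force simp: blinfun.diff_right)
  then show thesis using that \<open>d > 0\<close> by blast
qed

text \<open>Mazur's theorem for sequences: the positive gap of a separating functional would persist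
  in the weak limit.\<close>

lemma closed_convex_weakly_sequentially_closed:
  fixes S :: "'a::real_normed_vector set"
  assumes "closed S" "convex S" and xs: "\<And>n. xs n \<in> S" "limitin weak_topology xs x sequentially"
  shows "x \<in> S"
proof (rule ccontr)
  assume "x \<notin> S"
  have "S \<noteq> {}" using xs(1) by blast
  then obtain f :: "'a \<Rightarrow>\<^sub>L real" and d where f: "d > 0" "\<And>y. y \<in> S \<Longrightarrow> f y + d \<le> f x"
    using separating_functional[OF assms(1,2) _ \<open>x \<notin> S\<close>] by metis
  have "(\<lambda>n. f (xs n)) \<longlonglongrightarrow> f x" using xs(2) by (simp add: limitin_weak_topology)
  moreover have "f (xs n) \<le> f x - d" for n using f(2)[OF xs(1)[of n]] by simp
  ultimately have "f x \<le> f x - d" by (meson LIMSEQ_le_const2)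
  then show False using f(1) by simp
qed

section \<open>Weak sequential compactness\<close>

text \<open>Infinite values are sent to 0, so the definition is meaningful only for eventually
  bounded functions.\<close>

definition real_Limsup :: "'i filter \<Rightarrow> ('i \<Rightarrow> real) \<Rightarrow> real" where
  "real_Limsup F g = real_of_ereal (Limsup F (\<lambda>i. ereal (g i)))"

lemma real_Limsup:
  assumes "F \<noteq> bot" "\<forall>\<^sub>F i in F. \<bar>g i\<bar> \<le> M"
  shows ereal_real_Limsup: "ereal (real_Limsup F g) = Limsup F (\<lambda>i. ereal (g i))"
    and real_Limsup_le_iff: "real_Limsup F g \<le> c \<longleftrightarrow> (\<forall>d>c. \<forall>\<^sub>F i in F. g i < d)"
proof -
  have "Limsup F (\<lambda>i. ereal (g i)) \<le> ereal M"
    by (intro Limsup_bounded) (use assms(2) in \<open>auto elim!: eventually_mono\<close>)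
  moreover have "ereal (- M) \<le> Limsup F (\<lambda>i. ereal (g i))"
    by (intro le_Limsup assms(1)) (use assms(2) in \<open>auto elim!: eventually_mono\<close>)
  ultimately show eq: "ereal (real_Limsup F g) = Limsup F (\<lambda>i. ereal (g i))"
    unfolding real_Limsup_def by (cases "Limsup F (\<lambda>i. ereal (g i))") auto
  have "real_Limsup F g \<le> c \<longleftrightarrow> Limsup F (\<lambda>i. ereal (g i)) \<le> ereal c"
    by (simp flip: eq)
  also have "\<dots> \<longleftrightarrow> (\<forall>d>c. \<forall>\<^sub>F i in F. g i < d)"
    unfolding Limsup_le_iff
  proof (intro iffI allI impI)
    fix d assume "\<forall>y>ereal c. \<forall>\<^sub>F x in F. ereal (g x) < y" "c < d"
    then have "\<forall>\<^sub>F x in F. ereal (g x) < ereal d" by (metis less_ereal.simps(1))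
    then show "\<forall>\<^sub>F i in F. g i < d" by simp
  next
    fix y assume "\<forall>d>c. \<forall>\<^sub>F i in F. g i < d" "ereal c < y"
    then show "\<forall>\<^sub>F x in F. ereal (g x) < y" by (cases y) auto
  qed
  finally show "real_Limsup F g \<le> c \<longleftrightarrow> (\<forall>d>c. \<forall>\<^sub>F i in F. g i < d)" .
qed

text \<open>A Banach limit: reflexivity turns a linear functional on the dual that is dominated by
  \<open>\<lambda>\<phi>. limsup (\<lambda>n. \<phi> (y n))\<close> into a point, which lies in the closed convex hull of each tail.\<close>

lemma reflexive_banach_limit:
  fixes y :: "nat \<Rightarrow> 'a::real_normed_vector"
  assumes refl: "reflexive_space TYPE('a)" and bdd: "bounded (range y)"
  obtains z where
    "\<And>(\<phi> :: 'a \<Rightarrow>\<^sub>L real) c. \<forall>\<^sub>F n in sequentially. \<phi> (y n) \<le> c \<Longrightarrow> \<phi> z \<le> c"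
proof -
  obtain M where M: "\<And>n. norm (y n) \<le> M" "M > 0"
    using bdd unfolding bounded_pos by auto
  have bd: "\<bar>\<phi> (y n)\<bar> \<le> M * norm \<phi>" for n and \<phi> :: "'a \<Rightarrow>\<^sub>L real"
    using order_trans[OF norm_blinfun[of \<phi> "y n"] mult_left_mono[OF M(1)]]
    by (simp add: mult.commute)
  define p where "p \<phi> = real_Limsup sequentially (\<lambda>n. blinfun_apply \<phi> (y n))"
    for \<phi> :: "'a \<Rightarrow>\<^sub>L real"
  have p_le_iff: "p \<phi> \<le> c \<longleftrightarrow> (\<forall>d>c. \<forall>\<^sub>F n in sequentially. \<phi> (y n) < d)" for \<phi> c
    unfolding p_def using bd by (intro real_Limsup_le_iff[where M = "M * norm \<phi>"]) auto
  have pD: "\<forall>\<^sub>F n in sequentially. \<phi> (y n) < d" if "p \<phi> < d" for \<phi> d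
    using p_le_iff[of \<phi> "p \<phi>"] that by simp
  have "sublinear p"
    unfolding sublinear_def
  proof (intro conjI allI impI)
    fix \<phi> \<psi>
    have "\<forall>\<^sub>F n in sequentially. (\<phi> + \<psi>) (y n) < d" if "p \<phi> + p \<psi> < d" for d
    proof -
      define e where "e = (d - p \<phi> - p \<psi>) / 2"
      have "p \<phi> < p \<phi> + e" "p \<psi> < p \<psi> + e" "d = (p \<phi> + e) + (p \<psi> + e)"
        using that by (auto simp: e_def field_simps)
      with pD show ?thesis
        by (smt (verit, best) eventually_elim2 blinfun.add_left)
    qed
    then show "p (\<phi> + \<psi>) \<le> p \<phi> + p \<psi>" by (simp add: p_le_iff)
  next
    fix c :: real and \<phi> assume "0 < c"
    have "\<forall>\<^sub>F n in sequentially. (c *\<^sub>R \<phi>) (y n) < d" if "c * p \<phi> < d" for d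
    proof -
      have "p \<phi> < d / c" using that \<open>0 < c\<close> by (simp add: field_simps)
      from pD[OF this] show ?thesis
        by eventually_elim (use \<open>0 < c\<close> in \<open>simp add: field_simps blinfun.scaleR_left\<close>)
    qed
    then show "p (c *\<^sub>R \<phi>) \<le> c * p \<phi>" by (simp add: p_le_iff)
  qed
  moreover have "p \<phi> \<le> M * norm \<phi>" for \<phi>
    unfolding p_le_iff
  proof (intro allI impI always_eventually)
    fix d n assume "M * norm \<phi> < d"
    then show "\<phi> (y n) < d" using bd[of \<phi> n] by linarith
  qed
  \<comment> \<open>The set \<open>{0}\<close> with bound 0 imposes no condition, so this is plain
    Hahn--Banach domination by \<open>p\<close>.\<close>
  ultimately obtain \<Phi> where \<Phi>: "\<And>\<phi>. blinfun_apply \<Phi> \<phi> \<le> p \<phi>"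
    using mazur_orlicz_blinfun[of p M "{0}" 0] sublinear_zero[of p] by auto
  obtain z :: 'a where z: "\<And>\<phi>. blinfun_apply \<Phi> \<phi> = blinfun_apply \<phi> z"
    using refl unfolding reflexive_space_def by meson
  show thesis
  proof
    fix \<phi> :: "'a \<Rightarrow>\<^sub>L real" and c assume "\<forall>\<^sub>F n in sequentially. \<phi> (y n) \<le> c"
    then have "p \<phi> \<le> c" unfolding p_le_iff by (auto elim!: eventually_mono)
    then show "\<phi> z \<le> c" using \<Phi>[of \<phi>] z by simp
  qed
qed

section \<open>Whitley's argument with norming functionals\<close>

text \<open>If \<open>N d\<close> kills \<open>y\<close>, then \<open>norm d = N d (d - y)\<close>
  is at most \<open>norm (d - y)\<close>, so \<open>norm y\<close> is at most twice that distance.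
  Thus functionals indexed by \<open>D\<close> alone already separate points when
  \<open>closure D\<close> is a subspace.\<close>

lemma norming_family_separates:
  fixes N :: "'a::real_normed_vector \<Rightarrow> 'a \<Rightarrow>\<^sub>L real"
  assumes N: "\<And>d. norm (N d) \<le> 1" "\<And>d. N d d = norm d"
    and y: "y \<in> closure D" "\<And>d. d \<in> D \<Longrightarrow> N d y = 0"
  shows "y = 0"
proof (rule ccontr)
  assume "y \<noteq> 0"
  then obtain d where d: "d \<in> D" "dist d y < norm y / 2"
    using y(1) unfolding closure_approachable by (meson half_gt_zero zero_less_norm_iff)
  have "norm d = N d (d - y)" using N(2) y(2)[OF d(1)] by (simp add: blinfun.diff_right)
  also have "\<dots> \<le> norm (N d) * norm (d - y)"
    using norm_blinfun[of "N d" "d - y"] by simp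
  also have "\<dots> \<le> norm (d - y)" using N(1)[of d] by (simp add: mult_left_le_one_le)
  finally have "norm d \<le> norm (d - y)" .
  moreover have "norm y \<le> norm d + norm (d - y)"
    using norm_triangle_sub[of y d] by (simp add: norm_minus_commute)
  ultimately show False using d(2) by (simp add: dist_norm)
qed

text \<open>Every subsequence has a Banach limit in \<open>closure D\<close>, and convergence of
  each \<open>N d (x n)\<close> fixes its value under \<open>N d\<close>. All these Banach limits
  therefore coincide, which forces weak convergence.\<close>

lemma weakly_convergent_of_norming_family:
  fixes x :: "nat \<Rightarrow> 'a::real_normed_vector"
  assumes refl: "reflexive_space TYPE('a)" and bdd: "bounded (range x)"
    and D: "subspace (closure D)" and xD: "\<And>n. x n \<in> closure D"
    and N: "\<And>d. norm (N d) \<le> 1" "\<And>d. blinfun_apply (N d) d = norm d"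
    and conv: "\<And>d. d \<in> D \<Longrightarrow> convergent (\<lambda>n. N d (x n))"
  obtains z where "z \<in> closure D" "limitin weak_topology x z sequentially"
proof -
  \<comment> \<open>Here \<open>z\<close> is a Banach limit of the subsequence
    \<open>x (r n)\<close>. Upper bounds suffice, since lower bounds come from
    \<open>- \<phi>\<close>.\<close>
  define BL where "BL r z \<longleftrightarrow> (\<forall>(\<phi> :: 'a \<Rightarrow>\<^sub>L real) c.
    (\<forall>\<^sub>F n in sequentially. \<phi> (x (r n)) \<le> c) \<longrightarrow> \<phi> z \<le> c)" for r :: "nat \<Rightarrow> nat" and z
  have BLD: "\<phi> z \<le> c" if "BL r z" "\<forall>\<^sub>F n in sequentially. \<phi> (x (r n)) \<le> c"
    for r z c and \<phi> :: "'a \<Rightarrow>\<^sub>L real"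
    using that unfolding BL_def by blast
  have ex: "\<exists>z. BL r z" for r
  proof -
    have "bounded (range (\<lambda>n. x (r n)))" by (rule bounded_subset[OF bdd]) auto
    from reflexive_banach_limit[OF refl this] show ?thesis unfolding BL_def by metis
  qed
  \<comment> \<open>A functional separating \<open>z\<close> from \<open>closure D\<close> would
    violate the upper bound that the sequence itself satisfies.\<close>
  have in_cl: "z \<in> closure D" if "BL r z" for r z
  proof (rule ccontr)
    assume z: "z \<notin> closure D"
    have "closure D \<noteq> {}" using xD[of 0] by force
    then obtain \<phi> :: "'a \<Rightarrow>\<^sub>L real" and d
      where \<phi>: "d > 0" "\<And>y. y \<in> closure D \<Longrightarrow> \<phi> y + d \<le> \<phi> z"
      using separating_functional[OF closed_closure subspace_imp_convex[OF D] _ z] by metis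
    have "\<phi> z \<le> \<phi> z - d"
      by (rule BLD[OF that]) (use \<phi>(2)[OF xD] in \<open>simp add: le_diff_eq\<close>)
    then show False using \<phi>(1) by simp
  qed
  have lim: "\<phi> z \<le> l" if "BL r z" "strict_mono r" "(\<lambda>n. \<phi> (x n)) \<longlonglongrightarrow> l"
    for r z l and \<phi> :: "'a \<Rightarrow>\<^sub>L real"
  proof (rule field_le_epsilon)
    fix e :: real assume "e > 0"
    have "(\<lambda>n. \<phi> (x (r n))) \<longlonglongrightarrow> l"
      using LIMSEQ_subseq_LIMSEQ[OF that(3,2)] by (simp add: o_def)
    then have "\<forall>\<^sub>F n in sequentially. \<phi> (x (r n)) < l + e"
      using \<open>e > 0\<close> by (intro order_tendstoD) auto
    then show "\<phi> z \<le> l + e"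
      by (intro BLD[OF that(1)]) (auto elim: eventually_mono)
  qed
  have lim_eq: "\<phi> z = l" if "BL r z" "strict_mono r" "(\<lambda>n. \<phi> (x n)) \<longlonglongrightarrow> l"
    for r z l and \<phi> :: "'a \<Rightarrow>\<^sub>L real"
    using lim[OF that] lim[OF that(1,2), of "- \<phi>" "- l"] tendsto_minus[OF that(3)]
    by (simp add: blinfun.minus_left)
  have uniq: "z' = z" if "BL r z" "strict_mono r" "BL r' z'" "strict_mono r'" for r r' z z'
  proof -
    have "N d (z' - z) = 0" if d: "d \<in> D" for d
    proof -
      obtain l where "(\<lambda>n. N d (x n)) \<longlonglongrightarrow> l"
        using conv[OF d] unfolding convergent_def by blast
      then show ?thesis
        using lim_eq[OF \<open>BL r z\<close> \<open>strict_mono r\<close>] lim_eq[OF \<open>BL r' z'\<close> \<open>strict_mono r'\<close>]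
        by (simp add: blinfun.diff_right)
    qed
    moreover have "z' - z \<in> closure D"
      using D in_cl that by (intro subspace_diff) auto
    ultimately have "z' - z = 0" by (intro norming_family_separates[OF N]) auto
    then show ?thesis by simp
  qed
  obtain z where z: "BL id z" using ex by blast
  \<comment> \<open>A subsequence on which \<open>\<phi>\<close> stays at or above \<open>c\<close>
    has a Banach limit of its own, where \<open>\<phi>\<close> is at least \<open>c\<close>. By
    uniqueness that limit is \<open>z\<close>, a contradiction.\<close>
  have upper: "\<forall>\<^sub>F n in sequentially. \<phi> (x n) < c" if "\<phi> z < c" for \<phi> :: "'a \<Rightarrow>\<^sub>L real" and c
  proof (rule ccontr)
    assume "\<not> ?thesis"
    from not_eventually_sequentiallyD[OF this]
    obtain r :: "nat \<Rightarrow> nat" where r: "strict_mono r" "\<And>n. \<not> \<phi> (x (r n)) < c" by blast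
    obtain z' where z': "BL r z'" using ex by blast
    have "(- \<phi>) z' \<le> - c"
      by (rule BLD[OF z']) (use r(2) in \<open>auto simp: blinfun.minus_left not_less\<close>)
    moreover have "z' = z" using uniq[OF z _ z' r(1)] by (simp add: strict_mono_id)
    ultimately show False using that by (simp add: blinfun.minus_left)
  qed
  have "(\<lambda>n. \<phi> (x n)) \<longlonglongrightarrow> \<phi> z" for \<phi> :: "'a \<Rightarrow>\<^sub>L real"
  proof (rule order_tendstoI)
    show "\<forall>\<^sub>F n in sequentially. \<phi> (x n) < c" if "\<phi> z < c" for c by (rule upper[OF that])
    show "\<forall>\<^sub>F n in sequentially. c < \<phi> (x n)" if "c < \<phi> z" for c
      using upper[of "- \<phi>" "- c"] that by (simp add: blinfun.minus_left)
  qed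
  then show thesis using that in_cl[OF z] by (simp add: limitin_weak_topology)
qed

lemma subspace_closure_rational:
  fixes D :: "'a::real_normed_vector set"
  assumes ne: "D \<noteq> {}" and add: "\<And>a b. a \<in> D \<Longrightarrow> b \<in> D \<Longrightarrow> a + b \<in> D"
    and scale: "\<And>a q. a \<in> D \<Longrightarrow> q \<in> \<rat> \<Longrightarrow> q *\<^sub>R a \<in> D"
  shows "subspace (closure D)"
proof (rule subspaceI)
  show "0 \<in> closure D"
    using ne scale[of _ 0] closure_subset[of D] by auto
next
  fix x y assume "x \<in> closure D" "y \<in> closure D"
  then obtain a b where ab: "\<And>n. a n \<in> D" "a \<longlonglongrightarrow> x" "\<And>n. b n \<in> D" "b \<longlonglongrightarrow> y"
    unfolding closure_sequential by metis
  then have "(\<lambda>n. a n + b n) \<longlonglongrightarrow> x + y" "\<And>n. a n + b n \<in> D"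
    by (auto intro: tendsto_add add)
  then show "x + y \<in> closure D"
    unfolding closure_sequential by (intro exI[of _ "\<lambda>n. a n + b n"]) simp
next
  fix c :: real and x assume "x \<in> closure D"
  then obtain a where a: "\<And>n. a n \<in> D" "a \<longlonglongrightarrow> x"
    unfolding closure_sequential by metis
  have "c \<in> closure \<rat>" by (simp add: Rats_closure_real)
  then obtain q where q: "\<And>n. q n \<in> \<rat>" "q \<longlonglongrightarrow> c"
    unfolding closure_sequential by metis
  have "(\<lambda>n. q n *\<^sub>R a n) \<longlonglongrightarrow> c *\<^sub>R x" "\<And>n. q n *\<^sub>R a n \<in> D"
    using a q by (auto intro: tendsto_scaleR scale)
  then show "c *\<^sub>R x \<in> closure D"
    unfolding closure_sequential by (intro exI[of _ "\<lambda>n. q n *\<^sub>R a n"]) simp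
qed

text \<open>Finite stages exhausting the rational span of a sequence; finiteness of each stage is what
  allows the next term of the sequence to be chosen depending on it.\<close>

definition span_step :: "nat \<Rightarrow> 'a::real_vector \<Rightarrow> 'a set \<Rightarrow> 'a set" where
  "span_step n x D = insert x D \<union> (\<lambda>(a, b). a + b) ` (D \<times> D) \<union>
     (\<lambda>(j, a). real_of_rat (from_nat j) *\<^sub>R a) ` ({..n} \<times> D)"

lemma finite_span_step: "finite D \<Longrightarrow> finite (span_step n x D)"
  by (simp add: span_step_def)

lemma span_stages:
  fixes D :: "nat \<Rightarrow> 'a::real_normed_vector set"
  assumes D: "\<And>n. D (Suc n) = span_step n (x n) (D n)"
  shows "mono D" "\<And>n. x n \<in> (\<Union>n. D n)" "subspace (closure (\<Union>n. D n))"
proof -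
  show mono: "mono D"
    by (intro incseq_SucI) (auto simp: D span_step_def)
  show x: "x n \<in> (\<Union>n. D n)" for n
    by (rule UN_I[of "Suc n"]) (simp_all add: D span_step_def)
  show "subspace (closure (\<Union>n. D n))"
  proof (rule subspace_closure_rational)
    show "(\<Union>n. D n) \<noteq> {}" using x by blast
  next
    fix a b assume "a \<in> (\<Union>n. D n)" "b \<in> (\<Union>n. D n)"
    then obtain m n where "a \<in> D m" "b \<in> D n" by blast
    then have "a \<in> D (max m n)" "b \<in> D (max m n)"
      using monoD[OF mono, of m "max m n"] monoD[OF mono, of n "max m n"] by auto
    then have "a + b \<in> D (Suc (max m n))" unfolding D span_step_def by force
    then show "a + b \<in> (\<Union>n. D n)" by blast
  next
    fix a :: 'a and q :: real assume "a \<in> (\<Union>n. D n)" "q \<in> \<rat>"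
    then obtain m r where m: "a \<in> D m" "q = real_of_rat r" by (auto elim: Rats_cases)
    \<comment> \<open>Stage \<open>n\<close> scales only by the rationals with code at most
      \<open>n\<close>, so the stage must pass both \<open>m\<close> and \<open>j\<close>.\<close>
    define j where "j = to_nat r"
    have "q = real_of_rat (from_nat j)" by (simp add: j_def m)
    moreover have "a \<in> D (max m j)" using m(1) monoD[OF mono, of m "max m j"] by auto
    ultimately have "q *\<^sub>R a \<in> D (Suc (max m j))" unfolding D span_step_def by force
    then show "q *\<^sub>R a \<in> (\<Union>n. D n)" by blast
  qed
qed

lemma norming_family_exists:
  obtains N :: "'a::real_normed_vector \<Rightarrow> 'a \<Rightarrow>\<^sub>L real"
  where "\<And>d. norm (N d) \<le> 1" "\<And>d. N d d = norm d"
  using norming_functional by metis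

text \<open>The rational span of the sequence is countable, so a diagonal subsequence makes
  \<open>N d (x n)\<close> converge for every \<open>d\<close> in it. Whitley's argument then
  upgrades this to weak convergence.\<close>

theorem eberlein_smulian_subsequence:
  fixes x :: "nat \<Rightarrow> 'a::real_normed_vector"
  assumes refl: "reflexive_space TYPE('a)" and bdd: "bounded (range x)"
  obtains z r where "strict_mono (r :: nat \<Rightarrow> nat)" "limitin weak_topology (x \<circ> r) z sequentially"
proof -
  obtain N :: "'a \<Rightarrow> 'a \<Rightarrow>\<^sub>L real" where N: "\<And>d. norm (N d) \<le> 1" "\<And>d. N d d = norm d"
    using norming_family_exists by blast
  define D where "D = rec_nat {} (\<lambda>n. span_step n (x n))"
  have D: "D (Suc n) = span_step n (x n) (D n)" for n by (simp add: D_def)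
  have "finite (D n)" for n
    by (induction n) (simp_all add: D finite_span_step, simp add: D_def)
  then have cD: "countable (\<Union>n. D n)" by (simp add: countable_finite)
  obtain M where M: "\<And>n. norm (x n) \<le> M"
    using bdd unfolding bounded_pos by auto
  have bound: "norm (N d (x n)) \<le> M" for d n
  proof -
    have "norm (N d (x n)) \<le> norm (N d) * norm (x n)" by (rule norm_blinfun)
    also have "\<dots> \<le> norm (x n)" using N(1)[of d] by (simp add: mult_left_le_one_le)
    finally show ?thesis using M[of n] by linarith
  qed
  obtain r where r: "strict_mono (r :: nat \<Rightarrow> nat)"
      "\<And>d. d \<in> (\<Union>n. D n) \<Longrightarrow> \<exists>l. (\<lambda>n. N d (x (r n))) \<longlonglongrightarrow> l"
    using function_convergent_subsequence[where f = "\<lambda>n d. N d (x n)", OF cD bound] by metis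
  obtain z where "limitin weak_topology (x \<circ> r) z sequentially"
  proof (rule weakly_convergent_of_norming_family[OF refl _ span_stages(3)[OF D] _ N])
    show "bounded (range (x \<circ> r))" by (rule bounded_subset[OF bdd]) auto
    show "(x \<circ> r) n \<in> closure (\<Union>n. D n)" for n
      using span_stages(2)[of D x, OF D] closure_subset by (metis comp_apply subsetD)
    show "convergent (\<lambda>n. N d ((x \<circ> r) n))" if "d \<in> (\<Union>n. D n)" for d
      using r(2)[OF that] by (simp add: convergent_def)
  qed
  with r(1) show thesis using that by blast
qed

text \<open>Each \<open>x n\<close> is chosen close to \<open>z\<close> under the finitely many
  norming functionals of the stage built from \<open>z\<close> and the earlier terms. In the limit
  all of these functionals agree at \<open>z\<close> and at the weak limit of the sequence, so the
  two points are equal.\<close>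

theorem weak_closure_sequential:
  fixes C :: "'a::real_normed_vector set"
  assumes refl: "reflexive_space TYPE('a)" and bdd: "bounded C"
    and z: "z \<in> weak_topology closure_of C"
  obtains x where "\<And>n. x n \<in> C" "limitin weak_topology x z sequentially"
proof -
  have near: "\<exists>x\<in>C. \<forall>\<phi>\<in>F. \<bar>\<phi> x - \<phi> z\<bar> < e"
    if "finite F" "0 < e" for F :: "('a \<Rightarrow>\<^sub>L real) set" and e
  proof -
    have "openin weak_topology (\<Inter>\<phi>\<in>F. blinfun_apply \<phi> -` ball (\<phi> z) e)"
    proof (cases "F = {}")
      case True
      then show ?thesis using openin_topspace[of "weak_topology :: 'a topology"] by simp
    next
      case False
      show ?thesis
        by (rule openin_INT2[OF that(1) False])
          (auto simp: weak_topology_def intro!: topology_generated_by_Basis)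
    qed
    moreover have "z \<in> (\<Inter>\<phi>\<in>F. blinfun_apply \<phi> -` ball (\<phi> z) e)" using that by simp
    ultimately obtain x where "x \<in> C" "x \<in> (\<Inter>\<phi>\<in>F. blinfun_apply \<phi> -` ball (\<phi> z) e)"
      using z unfolding in_closure_of by blast
    then show ?thesis by (intro bexI[of _ x]) (auto simp: dist_real_def abs_minus_commute)
  qed
  obtain N :: "'a \<Rightarrow> 'a \<Rightarrow>\<^sub>L real" where N: "\<And>d. norm (N d) \<le> 1" "\<And>d. N d d = norm d"
    using norming_family_exists by blast
  \<comment> \<open>A state pairs a finite stage with a point of \<open>C\<close> tested against it.
    Keeping \<open>z\<close> in the stage later places \<open>z' - z\<close> in the closed
    span.\<close>
  define P where "P n s \<longleftrightarrow> finite (fst s) \<and> z \<in> fst s \<and> snd s \<in> C \<and>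
    (\<forall>d\<in>fst s. \<bar>blinfun_apply (N d) (snd s) - N d z\<bar> < 1 / real (Suc n))" for n and s :: "'a set \<times> 'a"
  have step: "\<exists>x. P n (D, x)" if D: "finite D" "z \<in> D" for n D
    using near[of "N ` D" "1 / real (Suc n)"] D by (auto simp: P_def)
  have "\<exists>f. \<forall>n. P n (f n) \<and> fst (f (Suc n)) = span_step n (snd (f n)) (fst (f n))"
  \<comment> \<open>The next stage is determined by the present state; only the next point is
    chosen.\<close>
  proof (rule dependent_nat_choice)
    show "\<exists>s. P 0 s" using step[of "{z}"] by blast
    fix s n assume "P n s"
    then have "\<exists>x. P (Suc n) (span_step n (snd s) (fst s), x)"
      by (intro step) (auto simp: P_def finite_span_step, auto simp: span_step_def)
    then show "\<exists>s'. P (Suc n) s' \<and> fst s' = span_step n (snd s) (fst s)" by force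
  qed
  then obtain f where f: "\<And>n. P n (f n)" "\<And>n. fst (f (Suc n)) = span_step n (snd (f n)) (fst (f n))"
    by blast
  define D where "D n = fst (f n)" for n
  define x where "x n = snd (f n)" for n
  have D: "D (Suc n) = span_step n (x n) (D n)" for n using f(2) by (simp add: D_def x_def)
  have xC: "x n \<in> C" and zD: "z \<in> D n" for n using f(1)[of n] by (auto simp: P_def x_def D_def)
  have close: "\<bar>N d (x n) - N d z\<bar> < 1 / real (Suc n)" if "d \<in> D n" for d n
    using f(1)[of n] that by (auto simp: P_def x_def D_def)
  have lim: "(\<lambda>n. N d (x n)) \<longlonglongrightarrow> N d z" if "d \<in> (\<Union>n. D n)" for d
  proof -
    obtain m where "d \<in> D m" using \<open>d \<in> (\<Union>n. D n)\<close> by blast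
    then have "d \<in> D n" if "m \<le> n" for n using monoD[OF span_stages(1)[of D x, OF D] that] by blast
    then have "\<forall>\<^sub>F n in sequentially. norm (N d (x n) - N d z) \<le> 1 / real (Suc n)"
      using close unfolding eventually_sequentially by (metis less_imp_le real_norm_def)
    from Lim_null_comparison[OF this LIMSEQ_Suc[OF lim_1_over_n]] show ?thesis
      by (simp add: LIM_zero_iff)
  qed
  obtain z' where z': "z' \<in> closure (\<Union>n. D n)" "limitin weak_topology x z' sequentially"
  proof (rule weakly_convergent_of_norming_family[OF refl _ span_stages(3)[of D x, OF D] _ N])
    show "bounded (range x)" using xC by (intro bounded_subset[OF bdd]) auto
    show "x n \<in> closure (\<Union>n. D n)" for n
      using span_stages(2)[of D x, OF D] closure_subset by blast
    show "convergent (\<lambda>n. N d (x n))" if "d \<in> (\<Union>n. D n)" for d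
      using lim[OF that] by (auto simp: convergent_def)
  qed
  have "z' - z = 0"
  proof (rule norming_family_separates[OF N])
    show "z' - z \<in> closure (\<Union>n. D n)"
      using span_stages(3)[of D x, OF D] z'(1) zD closure_subset[of "\<Union>n. D n"]
      by (intro subspace_diff) auto
    show "N d (z' - z) = 0" if "d \<in> (\<Union>n. D n)" for d
    proof -
      have "(\<lambda>n. N d (x n)) \<longlonglongrightarrow> N d z'" using z'(2) by (simp add: limitin_weak_topology)
      then show ?thesis
        using LIMSEQ_unique[OF lim[OF that]] by (simp add: blinfun.diff_right)
    qed
  qed
  then show thesis using that[of x] xC z'(2) by simp
qed

text \<open>Pulling functionals back along the projections turns an element of the bidual of the
  product into one on each factor. The two representing points form the required pair, because each
  functional on the product splits over the coordinates.\<close>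

lemma reflexive_space_prod:
  assumes "reflexive_space TYPE('a::real_normed_vector)" "reflexive_space TYPE('b::real_normed_vector)"
  shows "reflexive_space TYPE('a \<times> 'b)"
  unfolding reflexive_space_def
proof
  fix \<Phi> :: "(('a \<times> 'b) \<Rightarrow>\<^sub>L real) \<Rightarrow>\<^sub>L real"
  define F where "F = (Blinfun fst :: ('a \<times> 'b) \<Rightarrow>\<^sub>L 'a)"
  define S where "S = (Blinfun snd :: ('a \<times> 'b) \<Rightarrow>\<^sub>L 'b)"
  define I where "I = (Blinfun (\<lambda>x. (x, 0)) :: 'a \<Rightarrow>\<^sub>L ('a \<times> 'b))"
  define K where "K = (Blinfun (\<lambda>x. (0, x)) :: 'b \<Rightarrow>\<^sub>L ('a \<times> 'b))"
  have F: "F p = fst p" and S: "S p = snd p" for p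
    by (simp_all add: F_def S_def bounded_linear_Blinfun_apply bounded_linear_fst bounded_linear_snd)
  have I: "I x = (x, 0)" for x unfolding I_def
    by (subst bounded_linear_Blinfun_apply)
      (auto intro: bounded_linear_Pair bounded_linear_ident bounded_linear_zero)
  have K: "K y = (0, y)" for y unfolding K_def
    by (subst bounded_linear_Blinfun_apply)
      (auto intro: bounded_linear_Pair bounded_linear_ident bounded_linear_zero)
  define \<Phi>1 where "\<Phi>1 = Blinfun (\<lambda>\<phi> :: 'a \<Rightarrow>\<^sub>L real. \<Phi> (\<phi> o\<^sub>L F))"
  define \<Phi>2 where "\<Phi>2 = Blinfun (\<lambda>\<phi> :: 'b \<Rightarrow>\<^sub>L real. \<Phi> (\<phi> o\<^sub>L S))"
  have 1: "\<Phi>1 \<phi> = \<Phi> (\<phi> o\<^sub>L F)" for \<phi> unfolding \<Phi>1_def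
    by (subst bounded_linear_Blinfun_apply)
      (auto intro: bounded_linear_compose[OF blinfun.bounded_linear_right]
        bounded_bilinear.bounded_linear_left[OF bounded_bilinear_blinfun_compose])
  have 2: "\<Phi>2 \<phi> = \<Phi> (\<phi> o\<^sub>L S)" for \<phi> unfolding \<Phi>2_def
    by (subst bounded_linear_Blinfun_apply)
      (auto intro: bounded_linear_compose[OF blinfun.bounded_linear_right]
        bounded_bilinear.bounded_linear_left[OF bounded_bilinear_blinfun_compose])
  obtain x where x: "\<And>\<phi>. \<Phi>1 \<phi> = blinfun_apply \<phi> x"
    using assms(1) unfolding reflexive_space_def by metis
  obtain y where y: "\<And>\<phi>. \<Phi>2 \<phi> = blinfun_apply \<phi> y"
    using assms(2) unfolding reflexive_space_def by metis
  have "\<Phi> \<psi> = \<psi> (x, y)" for \<psi>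
  proof -
    have split: "\<psi> p = \<psi> (fst p, 0) + \<psi> (0, snd p)" for p
      by (simp flip: blinfun.add_right)
    have "\<psi> = ((\<psi> o\<^sub>L I) o\<^sub>L F) + ((\<psi> o\<^sub>L K) o\<^sub>L S)"
      by (rule blinfun_eqI, subst split) (simp add: blinfun.add_left F S I K)
    then have "\<Phi> \<psi> = \<Phi> ((\<psi> o\<^sub>L I) o\<^sub>L F) + \<Phi> ((\<psi> o\<^sub>L K) o\<^sub>L S)"
      by (metis blinfun.add_right)
    also have "\<dots> = \<psi> (x, 0) + \<psi> (0, y)"
      unfolding 1[symmetric] 2[symmetric] x y by (simp add: I K)
    also have "\<dots> = \<psi> (x, y)" by (simp flip: blinfun.add_right)
    finally show ?thesis .
  qed
  then show "\<exists>p. \<forall>\<psi>. \<Phi> \<psi> = blinfun_apply \<psi> p" by blast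
qed

section \<open>The Clarke derivative\<close>

abbreviation clarke_filter :: "'a::real_normed_vector \<Rightarrow> (real \<times> 'a) filter" where
  "clarke_filter x \<equiv> at_right 0 \<times>\<^sub>F nhds x"

definition diff_quot :: "('a::real_normed_vector \<Rightarrow> real) \<Rightarrow> 'a \<Rightarrow> real \<times> 'a \<Rightarrow> real" where
  "diff_quot J z p = (J (snd p + fst p *\<^sub>R z) - J (snd p)) / fst p"

definition clarke_real :: "('a::real_normed_vector \<Rightarrow> real) \<Rightarrow> 'a \<Rightarrow> 'a \<Rightarrow> real" where
  "clarke_real J x z = real_Limsup (clarke_filter x) (diff_quot J z)"

lemma clarke_filter_neq_bot: "clarke_filter x \<noteq> bot"
  by (simp add: prod_filter_eq_bot)

text \<open>Moving the base point along \<open>t *\<^sub>R z\<close> stays within the limit process;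
  this is what subadditivity of the Clarke derivative needs.\<close>

lemma filterlim_clarke_shift:
  "filterlim (\<lambda>p. (fst p, snd p + fst p *\<^sub>R z)) (clarke_filter x) (clarke_filter x)"
proof (intro filterlim_Pair filterlim_fst)
  have "((\<lambda>p. fst p) \<longlongrightarrow> (0::real)) (clarke_filter x)"
    by (rule filterlim_mono[OF filterlim_fst at_within_le_nhds order_refl])
  then have "((\<lambda>p. snd p + fst p *\<^sub>R z) \<longlongrightarrow> x + 0 *\<^sub>R z) (clarke_filter x)"
    by (intro tendsto_intros filterlim_snd)
  then show "filterlim (\<lambda>p. snd p + fst p *\<^sub>R z) (nhds x) (clarke_filter x)" by simp
qed

text \<open>The constant \<open>L\<close> is obtained before \<open>z\<close>, so the bound is
  uniform in the direction.\<close>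

lemma diff_quot_bounded:
  assumes "locally_lipschitz J"
  obtains L where "\<And>z. \<forall>\<^sub>F p in clarke_filter x. \<bar>diff_quot J z p\<bar> \<le> L * norm z"
proof -
  obtain r L where r: "r > 0" "L-lipschitz_on (ball x r) J"
    using assms unfolding locally_lipschitz_def by blast
  have "\<forall>\<^sub>F p in clarke_filter x. \<bar>diff_quot J z p\<bar> \<le> L * norm z" for z
  proof -
    have ball: "\<forall>\<^sub>F y in nhds x. y \<in> ball x r"
      using r(1) by (intro eventually_nhds_in_open) auto
    have "\<forall>\<^sub>F p in clarke_filter x. snd p \<in> ball x r"
      using filterlim_snd ball by (rule filterlim_iff[THEN iffD1, rule_format])
    moreover have "\<forall>\<^sub>F p in clarke_filter x. snd p + fst p *\<^sub>R z \<in> ball x r"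
      using filterlim_compose[OF filterlim_snd filterlim_clarke_shift[of z x]] ball
      by (auto simp: filterlim_iff)
    moreover have "\<forall>\<^sub>F p in clarke_filter x. 0 < fst p"
      using filterlim_fst eventually_at_right_less
      by (rule filterlim_iff[THEN iffD1, rule_format])
    ultimately show ?thesis
    proof eventually_elim
      case (elim p)
      have "\<bar>J (snd p + fst p *\<^sub>R z) - J (snd p)\<bar> \<le> L * norm (fst p *\<^sub>R z)"
        using lipschitz_onD[OF r(2) elim(2,1)] by (simp add: dist_norm)
      then show ?case
        using elim(3) by (simp add: diff_quot_def field_simps)
    qed
  qed
  then show thesis by (rule that)
qed

context
  fixes J :: "'a::real_normed_vector \<Rightarrow> real"
  assumes lip: "locally_lipschitz J"
begin

lemma ereal_clarke_real: "clarke_deriv J x z = ereal (clarke_real J x z)"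
proof -
  obtain L where "\<forall>\<^sub>F p in clarke_filter x. \<bar>diff_quot J z p\<bar> \<le> L * norm z"
    using diff_quot_bounded[OF lip] by metis
  from ereal_real_Limsup[OF clarke_filter_neq_bot this] show ?thesis
    by (simp add: clarke_deriv_def clarke_real_def diff_quot_def[abs_def] case_prod_unfold)
qed

lemma clarke_real_le_iff:
  "clarke_real J x z \<le> c \<longleftrightarrow> (\<forall>d>c. \<forall>\<^sub>F p in clarke_filter x. diff_quot J z p < d)"
proof -
  obtain L where "\<forall>\<^sub>F p in clarke_filter x. \<bar>diff_quot J z p\<bar> \<le> L * norm z"
    using diff_quot_bounded[OF lip] by metis
  from real_Limsup_le_iff[OF clarke_filter_neq_bot this] show ?thesis
    by (simp add: clarke_real_def)
qed

lemma clarke_real_less: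
  "clarke_real J x z < d \<Longrightarrow> \<forall>\<^sub>F p in clarke_filter x. diff_quot J z p < d"
  using clarke_real_le_iff[of x z "clarke_real J x z"] by simp

lemma clarke_real_le_norm: "\<exists>L. \<forall>z. clarke_real J x z \<le> L * norm z"
proof -
  obtain L where L: "\<And>z. \<forall>\<^sub>F p in clarke_filter x. \<bar>diff_quot J z p\<bar> \<le> L * norm z"
    using diff_quot_bounded[OF lip] by metis
  have "clarke_real J x z \<le> L * norm z" for z
    unfolding clarke_real_le_iff using L[of z] by (auto elim!: eventually_mono)
  then show ?thesis by blast
qed

text \<open>The increment along \<open>y + z\<close> is split at the intermediate point
  \<open>snd p + fst p *\<^sub>R z\<close>. Homogeneity comes from the substitution of
  \<open>c * t\<close> for \<open>t\<close>.\<close>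

lemma sublinear_clarke_real: "sublinear (clarke_real J x)"
  unfolding sublinear_def
proof (intro conjI allI impI)
  fix y z
  have "\<forall>\<^sub>F p in clarke_filter x. diff_quot J (y + z) p < d"
    if "clarke_real J x y + clarke_real J x z < d" for d
  proof -
    define e where "e = (d - clarke_real J x y - clarke_real J x z) / 2"
    have e: "e > 0" using that by (simp add: e_def)
    have "\<forall>\<^sub>F p in clarke_filter x. diff_quot J y (fst p, snd p + fst p *\<^sub>R z) < clarke_real J x y + e"
      using filterlim_clarke_shift[of z x] clarke_real_less[of x y "clarke_real J x y + e"] e
      by (auto simp: filterlim_iff)
    moreover have "\<forall>\<^sub>F p in clarke_filter x. diff_quot J z p < clarke_real J x z + e"
      using e by (intro clarke_real_less) simp
    ultimately show ?thesis
    proof eventually_elim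
      case (elim p)
      have "diff_quot J (y + z) p = diff_quot J y (fst p, snd p + fst p *\<^sub>R z) + diff_quot J z p"
        by (simp add: diff_quot_def scaleR_right_distrib add_ac flip: add_divide_distrib)
      also have "\<dots> < d" using elim by (simp add: e_def field_simps)
      finally show ?case .
    qed
  qed
  then show "clarke_real J x (y + z) \<le> clarke_real J x y + clarke_real J x z"
    by (simp add: clarke_real_le_iff)
next
  fix c :: real and z assume c: "0 < c"
  have "\<forall>\<^sub>F p in clarke_filter x. diff_quot J (c *\<^sub>R z) p < d" if "c * clarke_real J x z < d" for d
  proof -
    have "filterlim (\<lambda>p. (c * fst p, snd p)) (clarke_filter x) (clarke_filter x)"
      using c by (intro filterlim_Pair filterlim_snd filterlim_times_pos[OF filterlim_fst]) auto
    moreover have "\<forall>\<^sub>F p in clarke_filter x. diff_quot J z p < d / c"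
      using that c by (intro clarke_real_less) (simp add: field_simps)
    ultimately have "\<forall>\<^sub>F p in clarke_filter x. diff_quot J z (c * fst p, snd p) < d / c"
      by (auto simp: filterlim_iff)
    then show ?thesis
    proof eventually_elim
      case (elim p)
      have "diff_quot J (c *\<^sub>R z) p = c * diff_quot J z (c * fst p, snd p)"
        using c by (simp add: diff_quot_def mult.commute)
      also have "\<dots> < d" using elim c by (simp add: pos_less_divide_eq mult.commute)
      finally show ?case .
    qed
  qed
  then show "clarke_real J x (c *\<^sub>R z) \<le> c * clarke_real J x z"
    by (simp add: clarke_real_le_iff)
qed

lemma clarke_gradient_iff: "\<xi> \<in> clarke_gradient J x \<longleftrightarrow> (\<forall>z. blinfun_apply \<xi> z \<le> clarke_real J x z)"
  by (simp add: clarke_gradient_def ereal_clarke_real)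

text \<open>Hahn--Banach below the Clarke derivative, prescribed on the singleton
  \<open>{z}\<close>. It also shows that the gradient is nonempty.\<close>

lemma clarke_gradient_attains:
  obtains \<xi> where "\<xi> \<in> clarke_gradient J x" "blinfun_apply \<xi> z = clarke_real J x z"
proof -
  obtain L where "\<And>z. clarke_real J x z \<le> L * norm z" using clarke_real_le_norm by blast
  then obtain \<xi> :: "'a \<Rightarrow>\<^sub>L real"
    where \<xi>: "\<And>y. \<xi> y \<le> clarke_real J x y" "\<And>k. k \<in> {z} \<Longrightarrow> clarke_real J x z \<le> \<xi> k"
    using mazur_orlicz_blinfun[OF sublinear_clarke_real, of x L "{z}" "clarke_real J x z"] by auto
  then show thesis using that[of \<xi>] by (auto simp: clarke_gradient_iff intro: antisym)
qed

text \<open>A property holding near \<open>x\<close> holds near every point close to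
  \<open>x\<close>, so one bound on the difference quotients serves all nearby base points.\<close>

lemma clarke_real_upper_semicontinuous:
  assumes "clarke_real J x z < c"
  shows "\<forall>\<^sub>F y in nhds x. clarke_real J y z \<le> c"
proof -
  obtain P Q where PQ: "eventually P (at_right 0)" "eventually Q (nhds x)"
      "\<And>t y. P t \<Longrightarrow> Q y \<Longrightarrow> diff_quot J z (t, y) < c"
    using clarke_real_less[OF assms] unfolding eventually_prod_filter by metis
  have "\<forall>\<^sub>F y in nhds x. eventually Q (nhds y)" using PQ(2) by (simp add: eventually_eventually)
  then show ?thesis
  proof eventually_elim
    case (elim y)
    have "\<forall>\<^sub>F p in clarke_filter y. diff_quot J z p < c"
      using PQ elim unfolding eventually_prod_filter by (intro exI[of _ P] exI[of _ Q]) auto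
    then show ?case
      unfolding clarke_real_le_iff by (auto elim!: eventually_mono)
  qed
qed

end

section \<open>The solution set\<close>

lemma limitin_weak_bounded_linear:
  fixes g :: "'a::real_normed_vector \<Rightarrow> real"
  assumes "limitin weak_topology xs x F" "bounded_linear g"
  shows "((\<lambda>n. g (xs n)) \<longlongrightarrow> g x) F"
  using assms(1)[unfolded limitin_weak_topology, rule_format, of "Blinfun g"]
  by (simp add: bounded_linear_Blinfun_apply assms(2))

locale mixed_hemivariational_inequality =
  fixes A :: "'v::banach \<Rightarrow> ('v \<Rightarrow>\<^sub>L real)"
    and J :: "'x::banach \<Rightarrow> real"
    and h :: "'v \<Rightarrow> real"
    and \<gamma> :: "'v \<Rightarrow>\<^sub>L 'x"
    and b :: "'v \<Rightarrow> 'e::banach \<Rightarrow> real"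
    and \<Lambda> :: "'e set"
    and \<theta> \<alpha>\<^sub>J \<beta>\<^sub>J \<alpha>\<^sub>b :: real
  assumes refl_V: "reflexive_space TYPE('v)"
    and refl_E: "reflexive_space TYPE('e)"
    and \<Lambda>: "\<Lambda> \<noteq> {}" "closed \<Lambda>" "convex \<Lambda>" "0 \<in> \<Lambda>"
    and A1: "\<And>w v. Limsup (at_right 0)
               (\<lambda>t::real. ereal (blinfun_apply (A (t *\<^sub>R w + (1 - t) *\<^sub>R v)) (w - v)))
             \<le> ereal (blinfun_apply (A v) (w - v))"
    and A2: "\<And>u v \<xi>\<^sub>u \<xi>\<^sub>v. \<xi>\<^sub>u \<in> clarke_gradient J (blinfun_apply \<gamma> u) \<Longrightarrow>
               \<xi>\<^sub>v \<in> clarke_gradient J (blinfun_apply \<gamma> v) \<Longrightarrow>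
               blinfun_apply (A u + (\<xi>\<^sub>u o\<^sub>L \<gamma>) - A v - (\<xi>\<^sub>v o\<^sub>L \<gamma>)) (u - v) \<ge> h (u - v)"
    and A3: "filterlim (\<lambda>v. blinfun_apply (A v) v / norm v powr max \<theta> 1) at_top at_infinity"
    and A4: "\<And>B. bounded B \<Longrightarrow> bounded (A ` B)"
    and J1: "locally_lipschitz J"
    and J2: "\<theta> \<ge> 0" "\<alpha>\<^sub>J \<ge> 0" "\<beta>\<^sub>J > 0"
            "\<And>x. clarke_deriv J x (- x) \<le> ereal (\<alpha>\<^sub>J + \<beta>\<^sub>J * norm x powr \<theta>)"
    and J3: "\<And>B. bounded B \<Longrightarrow> bounded (\<Union>x\<in>B. clarke_gradient J x)"
    and h0: "h 0 = 0"
    and h1: "\<And>v. Limsup (at_right 0) (\<lambda>t::real. ereal (h (t *\<^sub>R v) / t)) \<ge> 0"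
    and h2: "\<And>vs v. limitin weak_topology vs v sequentially \<Longrightarrow>
               ereal (h v) \<le> limsup (\<lambda>n. ereal (h (vs n)))"
    and b_bounded_bilinear: "bounded_bilinear b"
    and b_inf_sup: "\<alpha>\<^sub>b > 0"
            "(INF \<rho>\<in>UNIV - {0}. SUP v\<in>UNIV - {0}. ereal (b v \<rho> / (norm v * norm \<rho>))) \<ge> ereal \<alpha>\<^sub>b"
begin

abbreviation "sol \<equiv> solution_set A b J \<gamma> \<Lambda>"

lemma b_simps:
  "b (u - v) l = b u l - b v l" "b u (l - m) = b u l - b u m" "b (- u) l = - b u l"
  "b u (l + m) = b u l + b u m" "b (u + v) l = b u l + b v l"
  "b (c *\<^sub>R u) l = c * b u l" "b u (c *\<^sub>R l) = c * b u l" "b u 0 = 0"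
  using bounded_bilinear.diff_left[OF b_bounded_bilinear] bounded_bilinear.diff_right[OF b_bounded_bilinear]
    bounded_bilinear.minus_left[OF b_bounded_bilinear]
    bounded_bilinear.add_left[OF b_bounded_bilinear] bounded_bilinear.add_right[OF b_bounded_bilinear]
    bounded_bilinear.scaleR_left[OF b_bounded_bilinear] bounded_bilinear.scaleR_right[OF b_bounded_bilinear]
    bounded_bilinear.zero_right[OF b_bounded_bilinear]
  by simp_all

lemma sol_iff:
  "(u, l) \<in> sol f \<longleftrightarrow> l \<in> \<Lambda> \<and>
     (\<forall>v. f (v - u) \<le> A u (v - u) + b (v - u) l + clarke_real J (\<gamma> u) (\<gamma> (v - u))) \<and>
     (\<forall>\<rho>\<in>\<Lambda>. b u \<rho> \<le> b u l)"
  by (simp add: solution_set_def ereal_clarke_real[OF J1] b_simps blinfun.diff_right)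

text \<open>A Minty-type description: the constraint on \<open>\<lambda>\<close> is absorbed into the inequality through the
  extra test element \<open>\<rho>\<close>, so that all terms except \<open>h\<close> become affine in \<open>(u, \<lambda>)\<close>; in particular the
  weakly discontinuous term \<open>b u \<lambda>\<close> disappears.\<close>

lemma sol_iff_minty:
  "(u, l) \<in> sol f \<longleftrightarrow> l \<in> \<Lambda> \<and>
     (\<forall>v. \<forall>\<rho>\<in>\<Lambda>. \<forall>\<xi>\<in>clarke_gradient J (\<gamma> v).
        h (v - u) \<le> A v (v - u) + \<xi> (\<gamma> (v - u)) - f (v - u) + b v l - b u \<rho>)"
    (is "_ \<longleftrightarrow> _ \<and> ?M")
proof
  assume S: "(u, l) \<in> sol f"
  have ?M
  proof (intro allI ballI)
    fix v \<rho> \<xi> assume \<rho>: "\<rho> \<in> \<Lambda>" and \<xi>: "\<xi> \<in> clarke_gradient J (\<gamma> v)"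
    \<comment> \<open>A gradient attaining the derivative in direction \<open>v - u\<close> replaces
      the Clarke term by a linear one, to which (A2) applies.\<close>
    obtain \<eta> where \<eta>: "\<eta> \<in> clarke_gradient J (\<gamma> u)" "\<eta> (\<gamma> (v - u)) = clarke_real J (\<gamma> u) (\<gamma> (v - u))"
      using clarke_gradient_attains[OF J1] by metis
    have "h (v - u) \<le> A v (v - u) + \<xi> (\<gamma> (v - u)) - A u (v - u) - \<eta> (\<gamma> (v - u))"
      using A2[OF \<xi> \<eta>(1)] by (simp add: blinfun.diff_left blinfun.add_left)
    moreover have "f (v - u) \<le> A u (v - u) + b (v - u) l + \<eta> (\<gamma> (v - u))"
      using S unfolding sol_iff \<eta>(2) by blast
    moreover have "b u \<rho> \<le> b u l" using S \<rho> unfolding sol_iff by blast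
    ultimately show "h (v - u) \<le> A v (v - u) + \<xi> (\<gamma> (v - u)) - f (v - u) + b v l - b u \<rho>"
      unfolding b_simps(1) by linarith
  qed
  then show "l \<in> \<Lambda> \<and> ?M" using S unfolding sol_iff by blast
next
  assume R: "l \<in> \<Lambda> \<and> ?M"
  then have l: "l \<in> \<Lambda>" and M: "\<And>v \<rho> \<xi>. \<rho> \<in> \<Lambda> \<Longrightarrow> \<xi> \<in> clarke_gradient J (\<gamma> v) \<Longrightarrow>
      h (v - u) \<le> A v (v - u) + \<xi> (\<gamma> (v - u)) - f (v - u) + b v l - b u \<rho>"
    by blast+
  \<comment> \<open>The test point \<open>v = u\<close> leaves only the constraint, as
    \<open>h 0 = 0\<close>.\<close>
  have "b u \<rho> \<le> b u l" if "\<rho> \<in> \<Lambda>" for \<rho>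
  proof -
    obtain \<xi> where "\<xi> \<in> clarke_gradient J (\<gamma> u)" using clarke_gradient_attains[OF J1] by metis
    from M[OF that this] show ?thesis by (simp add: h0)
  qed
  \<comment> \<open>Minty's trick: test at points \<open>vt t\<close> on the segment from
    \<open>u\<close> to \<open>w\<close> with \<open>\<rho> = l\<close>, divide by \<open>t\<close>
    and let \<open>t\<close> tend to 0. The terms in \<open>A\<close>, \<open>J\<close> and
    \<open>h\<close> may each cost a third of \<open>e\<close>.\<close>
  moreover have "f (w - u) \<le> A u (w - u) + b (w - u) l + clarke_real J (\<gamma> u) (\<gamma> (w - u))" for w
  proof (rule field_le_epsilon)
    fix e :: real assume e: "e > 0"
    define z where "z = w - u"
    define vt where "vt t = t *\<^sub>R w + (1 - t) *\<^sub>R u" for t :: real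
    have vt: "vt t = u + t *\<^sub>R z" for t by (simp add: vt_def z_def algebra_simps)
    have "ereal (A u z) < ereal (A u z + e / 3)" using e by simp
    with A1[of w u, folded z_def vt_def]
    have "\<forall>\<^sub>F t in at_right 0. ereal (A (vt t) z) < ereal (A u z + e / 3)"
      unfolding Limsup_le_iff by blast
    moreover have "\<forall>\<^sub>F t in at_right 0. clarke_real J (\<gamma> (vt t)) (\<gamma> z) \<le> clarke_real J (\<gamma> u) (\<gamma> z) + e / 3"
    proof -
      have "((\<lambda>t. \<gamma> (u + t *\<^sub>R z)) \<longlongrightarrow> \<gamma> (u + 0 *\<^sub>R z)) (at_right 0)"
        by (intro tendsto_intros)
      then have "filterlim (\<lambda>t. \<gamma> (vt t)) (nhds (\<gamma> u)) (at_right 0)"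
        by (simp add: vt)
      then show ?thesis
        using clarke_real_upper_semicontinuous[OF J1, of "\<gamma> u" "\<gamma> z" "clarke_real J (\<gamma> u) (\<gamma> z) + e / 3"] e
        by (auto simp: filterlim_iff)
    qed
    moreover have "\<forall>\<^sub>F t in at_right 0. (0::real) < t" by (rule eventually_at_right_less)
    ultimately have ev: "\<forall>\<^sub>F t in at_right 0. A (vt t) z < A u z + e / 3 \<and>
        clarke_real J (\<gamma> (vt t)) (\<gamma> z) \<le> clarke_real J (\<gamma> u) (\<gamma> z) + e / 3 \<and> 0 < t"
      by eventually_elim simp
    \<comment> \<open>(h1) bounds an upper limit, so it gives good \<open>t\<close> only frequently.
      The other estimates hold eventually, hence a common \<open>t\<close> exists.\<close>
    have "\<exists>\<^sub>F t in at_right 0. - (e / 3) < h (t *\<^sub>R z) / t"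
    proof (rule ccontr)
      assume "\<not> ?thesis"
      then have "\<forall>\<^sub>F t in at_right 0. ereal (h (t *\<^sub>R z) / t) \<le> ereal (- (e / 3))"
        by (simp add: not_frequently not_less)
      from order_trans[OF h1 Limsup_bounded[OF this]] show False using e by simp
    qed
    from frequently_ex[OF frequently_eventually_frequently[OF this ev]]
    obtain t where t: "- (e / 3) < h (t *\<^sub>R z) / t" "A (vt t) z < A u z + e / 3"
        "clarke_real J (\<gamma> (vt t)) (\<gamma> z) \<le> clarke_real J (\<gamma> u) (\<gamma> z) + e / 3" "0 < t"
      by blast
    obtain \<xi> where \<xi>: "\<xi> \<in> clarke_gradient J (\<gamma> (vt t))" "\<xi> (\<gamma> z) = clarke_real J (\<gamma> (vt t)) (\<gamma> z)"
      using clarke_gradient_attains[OF J1] by metis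
    have "h (t *\<^sub>R z) \<le> t * (A (vt t) z + \<xi> (\<gamma> z) - f z + b z l)"
      using M[OF l \<xi>(1)] by (simp add: vt blinfun.scaleR_right b_simps algebra_simps)
    then have "h (t *\<^sub>R z) / t \<le> A (vt t) z + \<xi> (\<gamma> z) - f z + b z l"
      using t(4) by (simp add: field_simps)
    then show "f (w - u) \<le> A u (w - u) + b (w - u) l + clarke_real J (\<gamma> u) (\<gamma> (w - u)) + e"
      using t(1-3) \<xi>(2) unfolding z_def by linarith
  qed
  ultimately show "(u, l) \<in> sol f" unfolding sol_iff using l by blast
qed

section \<open>Convexity, boundedness and limits of solutions\<close>

text \<open>In the Minty form the right-hand side is jointly affine in \<open>(u, l)\<close>, while
  the left-hand side is convex in \<open>u\<close>.\<close>

lemma convex_sol: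
  assumes "convex_on UNIV h"
  shows "convex (sol f)"
proof (rule convexI)
  fix p q and s t :: real assume pq: "p \<in> sol f" "q \<in> sol f" and st: "0 \<le> s" "0 \<le> t" "s + t = 1"
  obtain u1 l1 u2 l2 where eq: "p = (u1, l1)" "q = (u2, l2)" by fastforce
  define u where "u = s *\<^sub>R u1 + t *\<^sub>R u2"
  define l where "l = s *\<^sub>R l1 + t *\<^sub>R l2"
  have 1: "(u1, l1) \<in> sol f" and 2: "(u2, l2) \<in> sol f" using pq eq by auto
  have t: "s = 1 - t" using st by simp
  have "l \<in> \<Lambda>" unfolding l_def
    using 1 2 st \<Lambda>(3) unfolding sol_iff_minty by (auto intro: convexD)
  moreover have "h (v - u) \<le> A v (v - u) + \<xi> (\<gamma> (v - u)) - f (v - u) + b v l - b u \<rho>"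
    if h: "\<rho> \<in> \<Lambda>" "\<xi> \<in> clarke_gradient J (\<gamma> v)" for v \<rho> \<xi>
  proof -
    define E where "E u l = A v (v - u) + \<xi> (\<gamma> (v - u)) - f (v - u) + b v l - b u \<rho>" for u l
    have E: "h (v - u1) \<le> E u1 l1" "h (v - u2) \<le> E u2 l2"
      using 1 2 h unfolding sol_iff_minty E_def by blast+
    have "v - u = s *\<^sub>R (v - u1) + t *\<^sub>R (v - u2)"
      by (simp add: u_def t algebra_simps)
    then have "h (v - u) \<le> s * h (v - u1) + t * h (v - u2)"
      using assms st unfolding convex_on_def by auto
    also have "\<dots> \<le> s * E u1 l1 + t * E u2 l2"
      using E st by (intro add_mono mult_left_mono)
    also have "\<dots> = E u l"
      unfolding E_def u_def l_def t
      by (simp add: blinfun.add_right blinfun.diff_right blinfun.scaleR_right b_simps algebra_simps)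
    finally show ?thesis unfolding E_def .
  qed
  ultimately have "(u, l) \<in> sol f" unfolding sol_iff_minty by blast
  then show "s *\<^sub>R p + t *\<^sub>R q \<in> sol f" by (simp add: eq u_def l_def)
qed

lemma bounded_sol:
  assumes "bounded B"
  shows "bounded (\<Union>f\<in>B. sol f)"
proof -
  obtain R where R: "\<And>f. f \<in> B \<Longrightarrow> norm f \<le> R" "R > 0"
    using assms unfolding bounded_pos by blast
  define m where "m = max \<theta> 1"
  \<comment> \<open>For \<open>norm u \<ge> 1\<close> the contributions of \<open>f\<close>, of the
    constant and of the growth term in (J2) are each dominated by a multiple of
    \<open>norm u powr m\<close>; \<open>K\<close> adds the three coefficients.\<close>
  define K where "K = R + \<alpha>\<^sub>J + \<beta>\<^sub>J * norm \<gamma> powr \<theta>"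
  have "\<forall>\<^sub>F v in at_infinity. K < A v v / norm v powr m"
    using A3 unfolding filterlim_at_top_dense m_def by blast
  then obtain r where r: "\<And>v. r \<le> norm v \<Longrightarrow> K < A v v / norm v powr m"
    unfolding eventually_at_infinity by blast
  define R1 where "R1 = max r 1"
  have ubound: "norm u \<le> R1" if S: "(u, l) \<in> sol f" and f: "f \<in> B" for u l f
  proof (rule ccontr)
    assume "\<not> ?thesis"
    then have n: "norm u \<ge> 1" "norm u \<ge> r" by (auto simp: R1_def)
    \<comment> \<open>Testing with \<open>\<rho> = 0\<close> gives \<open>b u l\<close> a sign, so
      the coupling term drops out of the inequality tested at \<open>v = 0\<close>.\<close>
    have "b u 0 \<le> b u l" using S \<Lambda>(4) unfolding sol_iff by blast
    moreover have "f (0 - u) \<le> A u (0 - u) + b (0 - u) l + clarke_real J (\<gamma> u) (\<gamma> (0 - u))"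
      using S unfolding sol_iff by blast
    moreover have "clarke_real J (\<gamma> u) (- \<gamma> u) \<le> \<alpha>\<^sub>J + \<beta>\<^sub>J * norm (\<gamma> u) powr \<theta>"
      using J2(4)[of "\<gamma> u"] unfolding ereal_clarke_real[OF J1] by simp
    ultimately have "A u u \<le> f u + \<alpha>\<^sub>J + \<beta>\<^sub>J * norm (\<gamma> u) powr \<theta>"
      by (simp add: b_simps blinfun.minus_right)
    moreover have "f u \<le> R * norm u powr m"
    proof -
      have "f u \<le> norm f * norm u" using norm_blinfun[of f u] by simp
      also have "\<dots> \<le> R * norm u" using R(1)[OF f] by (simp add: mult_right_mono)
      also have "\<dots> \<le> R * norm u powr m"
        using R(2) n(1) powr_mono[of 1 m "norm u"] by (simp add: m_def)
      finally show ?thesis .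
    qed
    moreover have "\<alpha>\<^sub>J \<le> \<alpha>\<^sub>J * norm u powr m"
      using J2(2) ge_one_powr_ge_zero[OF n(1), of m] by (simp add: m_def mult_le_cancel_left1)
    moreover have "\<beta>\<^sub>J * norm (\<gamma> u) powr \<theta> \<le> \<beta>\<^sub>J * (norm \<gamma> powr \<theta> * norm u powr m)"
    proof -
      have "norm (\<gamma> u) powr \<theta> \<le> (norm \<gamma> * norm u) powr \<theta>"
        using J2(1) norm_blinfun[of \<gamma> u] by (intro powr_mono2) auto
      also have "\<dots> = norm \<gamma> powr \<theta> * norm u powr \<theta>" by (simp add: powr_mult)
      also have "\<dots> \<le> norm \<gamma> powr \<theta> * norm u powr m"
        using n(1) by (intro mult_left_mono powr_mono) (auto simp: m_def)
      finally show ?thesis using J2(3) by simp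
    qed
    ultimately have "A u u \<le> K * norm u powr m"
      unfolding K_def by (simp add: algebra_simps)
    moreover have "norm u powr m > 0" using n(1) by auto
    ultimately have "A u u / norm u powr m \<le> K" by (simp add: field_simps)
    then show False using r[OF n(2)] by simp
  qed
  have "bounded (A ` cball 0 R1)" by (intro A4 bounded_cball)
  then obtain R2 where R2: "\<And>u. norm u \<le> R1 \<Longrightarrow> norm (A u) \<le> R2"
    unfolding bounded_pos by force
  have "bounded (\<Union>x\<in>\<gamma> ` cball 0 R1. clarke_gradient J x)"
    by (intro J3 bounded_linear_image bounded_cball blinfun.bounded_linear_right)
  then obtain R3 where R3: "\<And>u \<xi>. norm u \<le> R1 \<Longrightarrow> \<xi> \<in> clarke_gradient J (\<gamma> u) \<Longrightarrow> norm \<xi> \<le> R3"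
    unfolding bounded_pos by force
  define M where "M = R + R2 + R3 * norm \<gamma>"
  have lbound: "norm l \<le> M / \<alpha>\<^sub>b" if S: "(u, l) \<in> sol f" and f: "f \<in> B" for u l f
  proof -
    have u: "norm u \<le> R1" by (rule ubound[OF S f])
    \<comment> \<open>Testing with \<open>v = u - w\<close> isolates \<open>b w l\<close>; the bound
      on \<open>u\<close> controls \<open>A u\<close> and the gradients uniformly through (A4) and
      (J3).\<close>
    have bw: "b w l \<le> M * norm w" for w
    proof -
      obtain \<xi> where \<xi>: "\<xi> \<in> clarke_gradient J (\<gamma> u)" "\<xi> (\<gamma> (- w)) = clarke_real J (\<gamma> u) (\<gamma> (- w))"
        using clarke_gradient_attains[OF J1] by metis
      have "f ((u - w) - u) \<le> A u ((u - w) - u) + b ((u - w) - u) l +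
          clarke_real J (\<gamma> u) (\<gamma> ((u - w) - u))"
        using S unfolding sol_iff by blast
      then have "b w l \<le> f w - A u w - \<xi> (\<gamma> w)"
        using \<xi>(2) by (simp add: b_simps blinfun.minus_right)
      moreover have "f w \<le> R * norm w"
        using norm_blinfun[of f w] mult_right_mono[OF R(1)[OF f] norm_ge_zero[of w]] by simp
      moreover have "- A u w \<le> R2 * norm w"
        using norm_blinfun[of "A u" w] mult_right_mono[OF R2[OF u] norm_ge_zero[of w]] by simp
      moreover have "- \<xi> (\<gamma> w) \<le> R3 * norm \<gamma> * norm w"
      proof -
        have "- \<xi> (\<gamma> w) \<le> norm \<xi> * norm (\<gamma> w)" using norm_blinfun[of \<xi> "\<gamma> w"] by simp
        also have "\<dots> \<le> norm \<xi> * (norm \<gamma> * norm w)"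
          by (intro mult_left_mono norm_blinfun norm_ge_zero)
        also have "\<dots> \<le> R3 * (norm \<gamma> * norm w)"
          by (intro mult_right_mono R3[OF u \<xi>(1)]) simp
        finally show ?thesis by (simp add: mult.assoc)
      qed
      ultimately show ?thesis unfolding M_def by (simp add: algebra_simps)
    qed
    have "M \<ge> 0"
    proof -
      obtain \<xi> where "\<xi> \<in> clarke_gradient J (\<gamma> u)" using clarke_gradient_attains[OF J1] by metis
      then have "0 \<le> R3" using R3[OF u] norm_ge_zero[of \<xi>] by (meson order_trans)
      moreover have "0 \<le> R2" using R2[OF u] norm_ge_zero[of "A u"] by linarith
      ultimately show ?thesis using R(2) by (simp add: M_def)
    qed
    show ?thesis
    proof (cases "l = 0")
      case True
      then show ?thesis using \<open>M \<ge> 0\<close> b_inf_sup(1) by simp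
    next
      case False
      have "ereal \<alpha>\<^sub>b \<le> (SUP v\<in>UNIV - {0}. ereal (b v l / (norm v * norm l)))"
        by (rule order_trans[OF b_inf_sup(2) INF_lower]) (use False in simp)
      also have "\<dots> \<le> ereal (M / norm l)"
      proof (rule SUP_least)
        fix w :: 'v assume "w \<in> UNIV - {0}"
        then have "norm w > 0" "norm l > 0" using False by simp_all
        then show "ereal (b w l / (norm w * norm l)) \<le> ereal (M / norm l)"
          using bw[of w] by (simp add: field_simps)
      qed
      finally show ?thesis using False b_inf_sup(1) by (simp add: field_simps)
    qed
  qed
  have "(\<Union>f\<in>B. sol f) \<subseteq> cball 0 R1 \<times> cball 0 (M / \<alpha>\<^sub>b)"
    using ubound lbound by auto
  then show ?thesis by (rule bounded_subset[rotated]) (intro bounded_Times bounded_cball)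
qed

text \<open>The Minty form passes to the limit: its affine terms converge weakly and (h2) handles
  \<open>h\<close> along the sequence.\<close>

lemma sol_limit:
  assumes fs: "fs \<longlonglongrightarrow> f" and ws: "\<And>n. ws n \<in> sol (fs n)"
    and lim: "limitin weak_topology ws (u, l) sequentially" and l: "l \<in> \<Lambda>"
  shows "(u, l) \<in> sol f"
  unfolding sol_iff_minty
proof (intro conjI l allI ballI)
  fix v \<rho> \<xi> assume \<rho>: "\<rho> \<in> \<Lambda>" and \<xi>: "\<xi> \<in> clarke_gradient J (\<gamma> v)"
  define us where "us n = fst (ws n)" for n
  define ls where "ls n = snd (ws n)" for n
  have lim_u: "(\<lambda>n. g (us n)) \<longlonglongrightarrow> g u" if "bounded_linear g" for g :: "'v \<Rightarrow> real"
    using limitin_weak_bounded_linear[OF lim bounded_linear_compose[OF that bounded_linear_fst]]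
    by (simp add: us_def)
  have lim_l: "(\<lambda>n. g (ls n)) \<longlonglongrightarrow> g l" if "bounded_linear g" for g :: "'e \<Rightarrow> real"
    using limitin_weak_bounded_linear[OF lim bounded_linear_compose[OF that bounded_linear_snd]]
    by (simp add: ls_def)
  have lim_v: "(\<lambda>n. g (v - us n)) \<longlonglongrightarrow> g (v - u)" for g :: "'v \<Rightarrow>\<^sub>L real"
    using tendsto_diff[OF tendsto_const[of "g v"] lim_u[OF blinfun.bounded_linear_right[of g]]]
    by (simp add: blinfun.diff_right)
  \<comment> \<open>Boundedness of the solutions makes the product of the strongly convergent
    \<open>fs\<close> and the weakly convergent \<open>v - us n\<close> converge.\<close>
  have "bounded (\<Union>f\<in>range fs. sol f)"
    by (rule bounded_sol) (use convergent_imp_bounded[OF fs] in simp)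
  then obtain R where R: "\<And>p. p \<in> (\<Union>f\<in>range fs. sol f) \<Longrightarrow> norm p \<le> R"
    unfolding bounded_pos by blast
  have "norm (us n) \<le> R" for n
  proof -
    have "ws n \<in> (\<Union>f\<in>range fs. sol f)" using ws by blast
    from R[OF this] show ?thesis
      using norm_fst_le[of "fst (ws n)" "snd (ws n)"] unfolding us_def prod.collapse by linarith
  qed
  then have vR: "norm (v - us n) \<le> norm v + R" for n
    using norm_triangle_ineq4[of v "us n"] by (meson add_left_mono order_trans)
  have dom: "(\<lambda>n. norm (fs n - f) * (norm v + R)) \<longlonglongrightarrow> 0"
    using tendsto_mult_left_zero[OF tendsto_norm_zero[OF LIM_zero[OF fs]]] by simp
  have "norm ((fs n - f) (v - us n)) \<le> norm (fs n - f) * (norm v + R)" for n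
    by (rule order_trans[OF norm_blinfun mult_left_mono[OF vR norm_ge_zero]])
  then have "(\<lambda>n. (fs n - f) (v - us n)) \<longlonglongrightarrow> 0"
    by (rule Lim_null_comparison[OF always_eventually[OF allI] dom])
  from tendsto_add[OF this lim_v[of f]] have lim_f: "(\<lambda>n. fs n (v - us n)) \<longlonglongrightarrow> f (v - u)"
    by (simp add: blinfun.diff_left)
  define E where "E n = A v (v - us n) + (\<xi> o\<^sub>L \<gamma>) (v - us n) - fs n (v - us n) + b v (ls n) - b (us n) \<rho>"
    for n
  have lim_E: "E \<longlonglongrightarrow> A v (v - u) + (\<xi> o\<^sub>L \<gamma>) (v - u) - f (v - u) + b v l - b u \<rho>"
    unfolding E_def
    by (intro tendsto_add tendsto_diff lim_v lim_f lim_u lim_l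
        bounded_bilinear.bounded_linear_left[OF b_bounded_bilinear]
        bounded_bilinear.bounded_linear_right[OF b_bounded_bilinear])
  have le_E: "h (v - us n) \<le> E n" for n
    using ws[of n] \<rho> \<xi> sol_iff_minty[of "us n" "ls n" "fs n"]
    by (simp add: us_def ls_def E_def)
  have "ereal (h (v - u)) \<le> limsup (\<lambda>n. ereal (h (v - us n)))"
    using lim_v by (intro h2) (simp add: limitin_weak_topology)
  also have "\<dots> \<le> limsup (\<lambda>n. ereal (E n))"
    using le_E by (intro Limsup_mono always_eventually) simp
  also have "\<dots> = ereal (A v (v - u) + (\<xi> o\<^sub>L \<gamma>) (v - u) - f (v - u) + b v l - b u \<rho>)"
    using lim_E by (intro lim_imp_Limsup) auto
  finally show "h (v - u) \<le> A v (v - u) + \<xi> (\<gamma> (v - u)) - f (v - u) + b v l - b u \<rho>"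
    by simp
qed

lemma sol_subset: "sol f \<subseteq> UNIV \<times> \<Lambda>"
  by (auto simp: solution_set_def)

lemma reflexive_V_E: "reflexive_space TYPE('v \<times> 'e)"
  by (rule reflexive_space_prod[OF refl_V refl_E])

section \<open>Weak closedness, closed graph and upper semicontinuity\<close>

text \<open>Since \<open>sol f\<close> is bounded, each of its weak closure points is reached by a
  sequence, and \<open>sol_limit\<close> applies with constant \<open>f\<close>.\<close>

lemma closedin_sol: "closedin (subtopology weak_topology (UNIV \<times> \<Lambda>)) (sol f)"
  unfolding closedin_subtopology
proof (intro exI conjI)
  show "closedin weak_topology (weak_topology closure_of sol f)" by (rule closedin_closure_of)
  have "(u, l) \<in> sol f" if p: "(u, l) \<in> weak_topology closure_of sol f" and l: "l \<in> \<Lambda>" for u l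
  proof -
    have "bounded (sol f)" using bounded_sol[of "{f}"] by simp
    from weak_closure_sequential[OF reflexive_V_E this p]
    obtain ws where ws: "\<And>n. ws n \<in> sol f" "limitin weak_topology ws (u, l) sequentially" by metis
    show ?thesis by (rule sol_limit[OF tendsto_const ws l])
  qed
  then show "sol f = weak_topology closure_of sol f \<inter> (UNIV \<times> \<Lambda>)"
    using sol_subset closure_of_subset[of "sol f" weak_topology] by auto
qed

lemma seq_closed_graph_sol: "seq_closed_graph euclidean (subtopology weak_topology (UNIV \<times> \<Lambda>)) sol"
  unfolding seq_closed_graph_def
proof (intro allI impI, elim conjE)
  fix fs ws f w
  assume ws: "\<forall>n. fs n \<in> topspace euclidean \<and> ws n \<in> sol (fs n)"
    and lim: "limitin (prod_topology euclidean (subtopology weak_topology (UNIV \<times> \<Lambda>)))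
      (\<lambda>n. (fs n, ws n)) (f, w) sequentially"
  from lim have "fs \<longlonglongrightarrow> f" "limitin weak_topology ws w sequentially" "w \<in> UNIV \<times> \<Lambda>"
    by (auto simp: limitin_pairwise limitin_subtopology o_def)
  then show "w \<in> sol f" using sol_limit[of fs f ws "fst w" "snd w"] ws by auto
qed

text \<open>Failure would yield solutions outside \<open>G\<close> for data tending to
  \<open>f\<close>. They are bounded, so a subsequence converges weakly to an element of
  \<open>sol f\<close>, which lies in \<open>G\<close>.\<close>

lemma upper_semicontinuous_sol:
  "upper_semicontinuous_mv euclidean (subtopology weak_topology (UNIV \<times> \<Lambda>)) sol"
  unfolding upper_semicontinuous_mv_def
proof (intro conjI ballI allI impI)
  show "sol f \<subseteq> topspace (subtopology weak_topology (UNIV \<times> \<Lambda>))" for f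
    using sol_subset by simp
  fix f G assume G: "openin (subtopology weak_topology (UNIV \<times> \<Lambda>)) G \<and> sol f \<subseteq> G"
  then obtain G' where G': "openin weak_topology G'" "G = G' \<inter> (UNIV \<times> \<Lambda>)"
    unfolding openin_subtopology by blast
  show "\<exists>N. openin euclidean N \<and> f \<in> N \<and> (\<forall>g\<in>N. sol g \<subseteq> G)"
  proof (rule ccontr)
    assume neg: "\<not> ?thesis"
    have "\<exists>g w. dist f g < 1 / real (Suc n) \<and> w \<in> sol g \<and> w \<notin> G" for n
    proof -
      have "openin euclidean (ball f (1 / real (Suc n)))" "f \<in> ball f (1 / real (Suc n))" by auto
      with neg show ?thesis by (metis mem_ball subsetI)
    qed
    then obtain fs ws where fs: "\<And>n. dist f (fs n) < 1 / real (Suc n)"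
        and ws: "\<And>n. ws n \<in> sol (fs n)" "\<And>n. ws n \<notin> G" by metis
    have "fs \<longlonglongrightarrow> f"
    proof (rule metric_tendsto_imp_tendsto[OF LIMSEQ_Suc[OF lim_1_over_n]])
      show "\<forall>\<^sub>F n in sequentially. dist (fs n) f \<le> dist (1 / real (Suc n)) 0"
        using fs by (intro always_eventually allI) (simp add: dist_commute less_imp_le)
    qed
    have "bounded (\<Union>f\<in>range fs. sol f)"
      by (rule bounded_sol) (use convergent_imp_bounded[OF \<open>fs \<longlonglongrightarrow> f\<close>] in simp)
    then have "bounded (range ws)" by (rule bounded_subset) (use ws(1) in auto)
    from eberlein_smulian_subsequence[OF reflexive_V_E this]
    obtain w and r :: "nat \<Rightarrow> nat"
      where r: "strict_mono r" "limitin weak_topology (ws \<circ> r) w sequentially" by metis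
    \<comment> \<open>The limit must first be placed over \<open>\<Lambda>\<close>, by Mazur's
      theorem, before \<open>sol_limit\<close> can be used.\<close>
    have "w \<in> UNIV \<times> \<Lambda>"
    proof (rule closed_convex_weakly_sequentially_closed[OF _ _ _ r(2)])
      show "closed ((UNIV :: 'v set) \<times> \<Lambda>)" "convex ((UNIV :: 'v set) \<times> \<Lambda>)"
        using \<Lambda> by (auto intro: closed_Times convex_Times)
      show "(ws \<circ> r) n \<in> UNIV \<times> \<Lambda>" for n
        using ws(1)[of "r n"] sol_subset[of "fs (r n)"] by auto
    qed
    moreover have "(fst w, snd w) \<in> sol f"
    proof (rule sol_limit)
      show "(fs \<circ> r) \<longlonglongrightarrow> f" using LIMSEQ_subseq_LIMSEQ[OF \<open>fs \<longlonglongrightarrow> f\<close> r(1)] .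
      show "(ws \<circ> r) n \<in> sol ((fs \<circ> r) n)" for n using ws(1) by simp
      show "limitin weak_topology (ws \<circ> r) (fst w, snd w) sequentially" using r(2) by simp
      show "snd w \<in> \<Lambda>" using \<open>w \<in> UNIV \<times> \<Lambda>\<close> by auto
    qed
    ultimately have "w \<in> G'" using G G'(2) by auto
    with r(2) G'(1) have "\<forall>\<^sub>F n in sequentially. (ws \<circ> r) n \<in> G'"
      unfolding limitin_def by blast
    then obtain n where "ws (r n) \<in> G'" unfolding eventually_sequentially by auto
    then show False
      using ws(1)[of "r n"] ws(2)[of "r n"] sol_subset[of "fs (r n)"] G'(2) by auto
  qed
qed

end

theorem theorem11:
  fixes A :: "'v::banach \<Rightarrow> ('v \<Rightarrow>\<^sub>L real)"
    and J :: "'x::banach \<Rightarrow> real"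
    and h :: "'v \<Rightarrow> real"
    and \<gamma> :: "'v \<Rightarrow>\<^sub>L 'x"
    and b :: "'v \<Rightarrow> 'e::banach \<Rightarrow> real"
    and \<Lambda> :: "'e set"
    and \<theta> \<alpha>\<^sub>J \<beta>\<^sub>J \<alpha>\<^sub>b :: real
  assumes refl_V: "reflexive_space TYPE('v)"
    and refl_E: "reflexive_space TYPE('e)"
    and \<Lambda>: "\<Lambda> \<noteq> {}" "closed \<Lambda>" "convex \<Lambda>" "0 \<in> \<Lambda>"
    and A1: "\<And>w v. Limsup (at_right 0)
               (\<lambda>t::real. ereal (blinfun_apply (A (t *\<^sub>R w + (1 - t) *\<^sub>R v)) (w - v)))
             \<le> ereal (blinfun_apply (A v) (w - v))"
    and A2: "\<And>u v \<xi>\<^sub>u \<xi>\<^sub>v. \<xi>\<^sub>u \<in> clarke_gradient J (blinfun_apply \<gamma> u) \<Longrightarrow>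
               \<xi>\<^sub>v \<in> clarke_gradient J (blinfun_apply \<gamma> v) \<Longrightarrow>
               blinfun_apply (A u + (\<xi>\<^sub>u o\<^sub>L \<gamma>) - A v - (\<xi>\<^sub>v o\<^sub>L \<gamma>)) (u - v) \<ge> h (u - v)"
    and A3: "filterlim (\<lambda>v. blinfun_apply (A v) v / norm v powr max \<theta> 1) at_top at_infinity"
    and A4: "\<And>B. bounded B \<Longrightarrow> bounded (A ` B)"
    and J1: "locally_lipschitz J"
    and J2: "\<theta> \<ge> 0" "\<alpha>\<^sub>J \<ge> 0" "\<beta>\<^sub>J > 0"
            "\<And>x. clarke_deriv J x (- x) \<le> ereal (\<alpha>\<^sub>J + \<beta>\<^sub>J * norm x powr \<theta>)"
    and J3: "\<And>B. bounded B \<Longrightarrow> bounded (\<Union>x\<in>B. clarke_gradient J x)"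
    and h0: "h 0 = 0"
    and h1: "\<And>v. Limsup (at_right 0) (\<lambda>t::real. ereal (h (t *\<^sub>R v) / t)) \<ge> 0"
    and h2: "\<And>vs v. limitin weak_topology vs v sequentially \<Longrightarrow>
               ereal (h v) \<le> limsup (\<lambda>n. ereal (h (vs n)))"
    and b_bounded_bilinear: "bounded_bilinear b"
    and b_inf_sup: "\<alpha>\<^sub>b > 0"
            "(INF \<rho>\<in>UNIV - {0}. SUP v\<in>UNIV - {0}. ereal (b v \<rho> / (norm v * norm \<rho>))) \<ge> ereal \<alpha>\<^sub>b"
  shows "(\<forall>f. bounded (solution_set A b J \<gamma> \<Lambda> f) \<and>
            closedin (subtopology weak_topology (UNIV \<times> \<Lambda>)) (solution_set A b J \<gamma> \<Lambda> f)) \<and>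
         (convex_on UNIV h \<longrightarrow> (\<forall>f. convex (solution_set A b J \<gamma> \<Lambda> f))) \<and>
         (\<forall>B. bounded B \<longrightarrow> bounded (\<Union>f\<in>B. solution_set A b J \<gamma> \<Lambda> f)) \<and>
         upper_semicontinuous_mv euclidean (subtopology weak_topology (UNIV \<times> \<Lambda>))
           (solution_set A b J \<gamma> \<Lambda>) \<and>
         seq_closed_graph euclidean (subtopology weak_topology (UNIV \<times> \<Lambda>))
           (solution_set A b J \<gamma> \<Lambda>)"
proof -
  interpret mixed_hemivariational_inequality A J h \<gamma> b \<Lambda> \<theta> \<alpha>\<^sub>J \<beta>\<^sub>J \<alpha>\<^sub>b
    by (rule mixed_hemivariational_inequality.intro) (fact assms)+
  show ?thesis
    using closedin_sol convex_sol bounded_sol bounded_sol[of "{f}" for f]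
      upper_semicontinuous_sol seq_closed_graph_sol by simp
qed

end
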